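(* Let $\min(n,m)\ge 2$, $c\in\mathbb{R}^m$, $d\in\mathbb{R}^n$, $R\in\mathbb{R}^{n\times m}$, and let $\mathcal{E}_x=\{x_c+Fu : u\in\mathbb{R}^m,\|u\|\le 1\}$ and $\mathcal{E}_y=\{y_c+Gw : w\in\mathbb{R}^n,\|w\|\le 1\}$ be full-dimensional ellipsoids, with $F\in\mathbb{R}^{m\times m}$, $G\in\mathbb{R}^{n\times n}$ nonsingular. Consider the bilinear problem $$z^*=\min\{c^Tx+d^Ty+y^TRx \;:\; x\in\mathcal{E}_x,\ y\in\mathcal{E}_y\}.$$ Let $\gamma=c^Tx_c+d^Ty_c+y_c^TRx_c$, $c'=F^T(c+R^Ty_c)$, $d'=G^T(d+Rx_c)$, $R'=G^TRF$, and $C=\begin{pmatrix}0&c'^T\\ d'&R'\end{pmatrix}\in\mathbb{R}^{(n+1)\times(m+1)}$. Then $z^*-\gamma$ is equal to the optimal value of each of the following convex problems: (a) $\min\{\langle C,Z\rangle : Z\in\mathrm{SEP}(n+1,m+1),\ Z_{00}=1\}$; (b) $\max\{\alpha\in\mathbb{R} : C-\alpha E_{00}\in\mathrm{LOP}(n+1,m+1)\}$; (c) $\max\{\alpha\in\mathbb{R} : \mathcal{W}(C)-\alpha I+J\succeq 0 \text{ for some } J\in\mathcal{A}(n)\otimes\mathcal{A}(m)\}$; (d) $\min\{\langle\mathcal{W}(C),S\rangle : S\in S^{nm},\ S\succeq 0,\ \mathrm{tr}(S)=1,\ \langle J,S\rangle=0\ \text{for all } J\in\mathcal{A}(n)\o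times\mathcal{A}(m)\}$.
   Context: All matrices are real; $\langle A,B\rangle=\mathrm{tr}(AB^T)$; $\|\cdot\|$ is the Euclidean norm. Coordinates of vectors in $\mathbb{R}^r$, and rows and columns of matrices, are indexed starting from $0$; $e_i$ is the $i$th coordinate vector and $E_{00}=e_0e_0^T$ (of size $(n+1)\times(m+1)$). $S^r$ denotes the symmetric $r\times r$ matrices, and $\succeq 0$ means positive semidefinite. The Lorentz cone in $\mathbb{R}^r$ ($r\ge 3$) is $L_r=\{(y_0,\ldots,y_{r-1})^T : \sum_{i=1}^{r-1}y_i^2\le y_0^2,\ y_0\ge 0\}$. The Lorentz positive cone is $\mathrm{LOP}(n+1,m+1)=\{M\in\mathbb{R}^{(n+1)\times(m+1)} : Mx\in L_{n+1}\ \forall x\in L_{m+1}\}$. The Lorentz separable cone $\mathrm{SEP}(n+1,m+1)$ is the set of all $(n+1)\times(m+1)$ matrices that are finite sums $\sum_j y^j(x^j)^T$ with $y^j\in L_{n+1}$, $x^j\in L_{m+1}$. For $r\ge 3$ define the linear map $W_r:\mathbb{R}^r\to S^{r-1}$ by: $W_r(x)_{00}=x_0+x_1$; $W_r(x)_{ii}=x_0-x_1$ for $1\le i\le r-2$; $W_r(x)_{0i}=W_r(x)_{i0}=x_{i+1}$ for $1\le i\le r-2$; all other entries are $0$. The linear map $\mathcal{W}:\mathbb{R}^{(n+1)\times(m+1)}\to S^{nm}$ is $\mathcal{W}(A)=\sum_{i=0}^n\sum_{j=0}^m a_{ij}\,W_{n+1}(e_i)\otimes W_{m+1}(e_j)$,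 with $\otimes$ the Kronecker product. $\mathcal{A}(r)$ is the space of skew-symmetric $r\times r$ matrices, and $\mathcal{A}(n)\otimes\mathcal{A}(m)\subset S^{nm}$ is the linear span of all Kronecker products $B\otimes D$ with $B\in\mathcal{A}(n)$, $D\in\mathcal{A}(m)$. *)

theory Defs
  imports "HOL-Analysis.Analysis"
begin

text \<open>
  Index conventions. With \<open>n = CARD('n)\<close>, vectors in \<open>\<real>\<^sup>n\<close> are of type \<open>real ^ 'n\<close>, and vectors
  in \<open>\<real>\<^sup>n\<^sup>+\<^sup>1\<close> are of type \<open>real ^ 'n option\<close>: the coordinate 0 is \<open>None\<close>, and the coordinate
  \<open>i + 1\<close> is \<open>Some i\<close>, where \<open>i\<close> is the corresponding coordinate of \<open>\<real>\<^sup>n\<close>. An \<open>n \<times> m\<close> matrix is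
  of type \<open>real ^ 'm ^ 'n\<close>, and the \<open>nm \<times> nm\<close> matrices of a Kronecker product are indexed by
  \<open>'n \<times> 'm\<close>. As a finite type has no canonical first element, the element of \<open>'n\<close> that plays
  the role of the coordinate 0 of \<open>\<real>\<^sup>n\<close> is an explicit parameter where it matters.
\<close>

definition is_min_value :: "real set \<Rightarrow> real \<Rightarrow> bool" where
  "is_min_value S v \<longleftrightarrow> v \<in> S \<and> (\<forall>s\<in>S. v \<le> s)"

definition is_max_value :: "real set \<Rightarrow> real \<Rightarrow> bool" where
  "is_max_value S v \<longleftrightarrow> v \<in> S \<and> (\<forall>s\<in>S. s \<le> v)"

definition mat_inner :: "real ^ 'm ^ 'n \<Rightarrow> real ^ 'm ^ 'n \<Rightarrow> real" where
  "mat_inner A B = trace (A ** transpose B)"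

definition outer :: "real ^ 'n \<Rightarrow> real ^ 'm \<Rightarrow> real ^ 'm ^ 'n" where
  "outer y x = (\<chi> i j. y $ i * x $ j)"

definition E00 :: "real ^ ('m::finite) option ^ ('n::finite) option" where
  "E00 = outer (axis None 1) (axis None 1)"

definition ellipsoid :: "real ^ 'n \<Rightarrow> real ^ 'n ^ 'n \<Rightarrow> (real ^ 'n) set" where
  "ellipsoid a F = {a + F *v u |u. norm u \<le> 1}"

definition lorentz_cone :: "(real ^ ('n::finite) option) set" where
  "lorentz_cone = {y. (\<Sum>i\<in>UNIV. (y $ Some i)\<^sup>2) \<le> (y $ None)\<^sup>2 \<and> 0 \<le> y $ None}"

definition LOP :: "(real ^ ('m::finite) option ^ ('n::finite) option) set" where
  "LOP = {M. \<forall>x\<in>lorentz_cone. M *v x \<in> lorentz_cone}"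

definition SEP :: "(real ^ ('m::finite) option ^ ('n::finite) option) set" where
  "SEP = {Z. \<exists>(k::nat) y x. (\<forall>j<k. y j \<in> lorentz_cone \<and> x j \<in> lorentz_cone) \<and>
                Z = (\<Sum>j<k. outer (y j) (x j))}"

definition sym_mats :: "(real ^ 'n ^ 'n) set" where
  "sym_mats = {A. transpose A = A}"

definition skew_mats :: "(real ^ 'n ^ 'n) set" where
  "skew_mats = {A. transpose A = - A}"

definition psd :: "real ^ 'n ^ 'n \<Rightarrow> bool" where
  "psd A \<longleftrightarrow> A \<in> sym_mats \<and> (\<forall>v. 0 \<le> v \<bullet> (A *v v))"

definition kron :: "real ^ 'n ^ 'n \<Rightarrow> real ^ 'm ^ 'm \<Rightarrow> real ^ ('n \<times> 'm) ^ ('n \<times> 'm)" where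
  "kron B D = (\<chi> p q. B $ fst p $ fst q * D $ snd p $ snd q)"

definition skew_tensor :: "(real ^ (('n::finite) \<times> ('m::finite)) ^ ('n \<times> 'm)) set" where
  "skew_tensor = span {kron B D |B D. B \<in> skew_mats \<and> D \<in> skew_mats}"

text \<open>
  The map \<open>W\<^sub>r\<close> for \<open>r = CARD('n) + 1\<close>. The argument \<open>o\<^sub>n\<close> is the index 0 of the rows and columns
  of the result, so \<open>Some o\<^sub>n\<close> is the coordinate 1 of \<open>x\<close>.
\<close>

definition W :: "'n \<Rightarrow> real ^ 'n option \<Rightarrow> real ^ 'n ^ 'n" where
  "W o\<^sub>n x = (\<chi> i j.
     if i = o\<^sub>n \<and> j = o\<^sub>n then x $ None + x $ Some o\<^sub>n
     else if i = j then x $ None - x $ Some o\<^sub>n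
     else if i = o\<^sub>n then x $ Some j
     else if j = o\<^sub>n then x $ Some i
     else 0)"

definition WW :: "'n::finite \<Rightarrow> 'm::finite \<Rightarrow> real ^ 'm option ^ 'n option \<Rightarrow> real ^ ('n \<times> 'm) ^ ('n \<times> 'm)" where
  "WW o\<^sub>n o\<^sub>m A = (\<Sum>i\<in>UNIV. \<Sum>j\<in>UNIV. (A $ i $ j) *\<^sub>R kron (W o\<^sub>n (axis i 1)) (W o\<^sub>m (axis j 1)))"

text \<open>The block matrix with rows \<open>(0, a\<^sup>T)\<close> and \<open>(b, M)\<close>.\<close>

definition bordered :: "real ^ 'm \<Rightarrow> real ^ 'n \<Rightarrow> real ^ 'm ^ 'n \<Rightarrow> real ^ 'm option ^ 'n option" where
  "bordered a b M = (\<chi> i j. case i of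
       None \<Rightarrow> (case j of None \<Rightarrow> 0 | Some l \<Rightarrow> a $ l)
     | Some k \<Rightarrow> (case j of None \<Rightarrow> b $ k | Some l \<Rightarrow> M $ k $ l))"

end

theory Submission
  imports Defs
begin

text \<open>
  After the substitution \<open>x = x\<^sub>c + F u\<close>, \<open>y = y\<^sub>c + G w\<close> the objective is \<open>\<gamma>\<close> plus
  \<open>(1, w)\<^sup>T C (1, u)\<close>, and as this is affine in \<open>u\<close> and in \<open>w\<close> separately, its minimum \<open>a\<close> over
  two unit balls is attained on the two unit spheres, so at null vectors of the two Lorentz cones.
  By scaling, \<open>y\<^sup>T C x \<ge> a y\<^sub>0 x\<^sub>0\<close> for all \<open>x\<close>, \<open>y\<close> in the cones. This settles the problem
  over the separable cone, and by self-duality of the Lorentz cone the one over the positive cone.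

  The semidefinite problems rest on the quadratic map \<open>q(v) = (|v|\<^sup>2, 2 v\<^sub>o v - |v|\<^sup>2 e\<^sub>o)\<close>
  (\<open>nullv\<close>), where \<open>e\<^sub>o\<close> is the distinguished unit vector: it parametrises the null vectors of the
  Lorentz cone, and \<open>v\<^sup>T W(x) v = q(v)\<^sup>T x\<close>. Consequently the quadratic form of \<open>\<W>(M)\<close> at
  \<open>v \<otimes> w\<close> is \<open>q(v)\<^sup>T M q(w)\<close> (\<open>WW_quadratic\<close>). The forms in \<open>\<A>(n) \<otimes> \<A>(m)\<close> are exactly the
  symmetric ones that vanish at all \<open>v \<otimes> w\<close> (\<open>skew_tensor_quadratic\<close>, \<open>skew_tensorI\<close>). So \<open>\<W>(M) + J\<close>
  can be made positive semidefinite iff the biquadratic form \<open>q(v)\<^sup>T M q(w)\<close> is a sum of squares of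
  bilinear forms. One inequality for each of the two semidefinite problems follows by evaluating at the rank one matrix
  \<open>(v \<otimes> w)(v \<otimes> w)\<^sup>T\<close> with \<open>q(v)\<close>, \<open>q(w)\<close> the optimal null vectors.

  The other inequality requires that nonnegativity implies being a sum of squares, for forms \<open>q(v)\<^sup>T M q(w)\<close>. If \<open>M\<close>
  is strictly positive, the S-lemma gives \<open>\<mu> > 0\<close> such that \<open>Q(M x) - \<mu> Q(x)\<close> is a positive
  semidefinite form, hence equal to some \<open>|L x|\<^sup>2\<close>; here \<open>Q\<close> is the Lorentz form. Then \<open>x \<mapsto> (M x, L x)\<close>
  multiplies the Lorentz form by \<open>\<mu>\<close>, as a composition of an isometric embedding and a scaling. On
  the null vectors it is therefore a Moebius map; it consists of an inversion and similarities, and the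
  latter lift to linear maps along \<open>q\<close>. For the inversion, the form is
  \<open>|x|\<^sup>2 |y|\<^sup>2 + 2 s x \<bullet> y + s\<^sup>2\<close>, which is a sum of squares by Lagrange's identity
  (\<open>sos_lagrange\<close>); the coordinates \<open>x\<close>, \<open>y\<close> are found in \<open>sos_of_lorentz_square\<close>. Finally \<open>C - \<alpha> E\<^sub>0\<^sub>0\<close>
  is strictly positive for \<open>\<alpha> < a\<close>, and compactness permits the limit \<open>\<alpha> \<rightarrow> a\<close>.
\<close>

section \<open>Vectors with a distinguished coordinate\<close>

definition spat :: "real ^ ('n::finite) option \<Rightarrow> real ^ 'n" where
  "spat x = (\<chi> k. x $ Some k)"

definition lvec :: "real \<Rightarrow> real ^ ('n::finite) \<Rightarrow> real ^ 'n option" where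
  "lvec t u = (\<chi> i. case i of None \<Rightarrow> t | Some k \<Rightarrow> u $ k)"

definition mink :: "real ^ ('n::finite) option \<Rightarrow> real ^ 'n option \<Rightarrow> real" where
  "mink x y = x $ None * y $ None - spat x \<bullet> spat y"

lemma lvec_simps [simp]: "lvec t u $ None = t" "lvec t u $ Some k = u $ k" "spat (lvec t u) = u"
  by (auto simp: lvec_def spat_def vec_eq_iff)

lemma spat_nth [simp]: "spat x $ k = x $ Some k"
  by (simp add: spat_def)

lemma lvec_eta: "x = lvec (x $ None) (spat x)"
  by (auto simp: vec_eq_iff lvec_def split: option.splits)

lemma spat_arith:
  "spat (x + y) = spat x + spat y" "spat (x - y) = spat x - spat y" "spat (a *\<^sub>R x) = a *\<^sub>R spat x"
  "spat (- x) = - spat x" "spat 0 = 0"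
  by (auto simp: vec_eq_iff)

lemma sum_option:
  fixes f :: "'a::finite option \<Rightarrow> 'b::comm_monoid_add"
  shows "(\<Sum>i\<in>UNIV. f i) = f None + (\<Sum>k\<in>UNIV. f (Some k))"
  by (simp add: UNIV_option_conv sum.reindex)

lemma inner_option:
  fixes x :: "real ^ ('n::finite) option"
  shows "x \<bullet> y = x $ None * y $ None + spat x \<bullet> spat y"
  by (simp add: inner_vec_def sum_option)

lemma lorentz_cone_iff: "y \<in> lorentz_cone \<longleftrightarrow> norm (spat y) \<le> y $ None"
proof -
  have "(\<Sum>i\<in>UNIV. (y $ Some i)\<^sup>2) = (norm (spat y))\<^sup>2"
    unfolding power2_norm_eq_inner by (simp add: inner_vec_def power2_eq_square)
  then show ?thesis
    unfolding lorentz_cone_def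
    using abs_le_square_iff[of "norm (spat y)" "y $ None"]
    by (auto simp: order_trans[OF norm_ge_zero])
qed

lemma lorentz_cone_lvec: "lvec t u \<in> lorentz_cone \<longleftrightarrow> norm u \<le> t"
  by (simp add: lorentz_cone_iff)

lemma lorentz_cone_inner_nonneg:
  assumes "x \<in> lorentz_cone" "y \<in> lorentz_cone"
  shows "0 \<le> x \<bullet> y"
proof -
  have "\<bar>spat x \<bullet> spat y\<bar> \<le> norm (spat x) * norm (spat y)"
    by (rule Cauchy_Schwarz_ineq2)
  also have "\<dots> \<le> x $ None * y $ None"
    using assms order_trans[OF norm_ge_zero] unfolding lorentz_cone_iff by (intro mult_mono) auto
  finally show ?thesis by (simp add: inner_option)
qed

text \<open>
  Testing against \<open>(|z|, -z)\<close> for the spatial part \<open>z\<close> is the worst case. With \<open>s = 0\<close> this is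
  self-duality of the cone; a positive \<open>s\<close> shows how deep in the interior the vector lies.
\<close>
lemma lorentz_cone_self_dual_strict:
  assumes "\<And>y. y \<in> lorentz_cone \<Longrightarrow> s * y $ None \<le> y \<bullet> z"
  shows "norm (spat z) + s \<le> z $ None"
proof (cases "spat z = 0")
  case True
  then show ?thesis
    using assms[of "lvec 1 0"] by (simp add: lorentz_cone_lvec inner_option)
next
  case False
  let ?n = "norm (spat z)"
  have "s * ?n \<le> ?n * z $ None - ?n * ?n"
    using assms[of "lvec ?n (- spat z)"]
    by (simp add: lorentz_cone_lvec inner_option dot_square_norm power2_eq_square)
  then have "?n * (?n + s) \<le> ?n * z $ None"
    by (simp add: algebra_simps)
  then show ?thesis using False by simp
qed

section \<open>Positive semidefinite matrices\<close>

lemma sym_inner_swap: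
  fixes A :: "real ^ 'n ^ 'n"
  assumes "A \<in> sym_mats"
  shows "x \<bullet> (A *v y) = (A *v x) \<bullet> y"
  using assms by (metis (mono_tags) dot_lmul_matrix mem_Collect_eq sym_mats_def
    transpose_matrix_vector)

lemma sym_matsI: "(\<And>i j. A $ i $ j = A $ j $ i) \<Longrightarrow> A \<in> sym_mats"
  by (simp add: sym_mats_def transpose_def vec_eq_iff)

lemma sym_matsD: "A \<in> sym_mats \<Longrightarrow> A $ i $ j = A $ j $ i"
  by (simp add: sym_mats_def transpose_def vec_eq_iff)

lemma inner_transpose: "x \<bullet> (transpose A *v y) = (A *v x) \<bullet> y"
  for A :: "real ^ 'm ^ 'n"
  by (metis dot_lmul_matrix inner_commute transpose_matrix_vector)

lemma inner_mat_expand: "x \<bullet> (A *v y) = (\<Sum>i\<in>UNIV. \<Sum>j\<in>UNIV. A $ i $ j * x $ i * y $ j)"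
  for A :: "real ^ 'm ^ 'n"
  by (simp add: inner_vec_def matrix_vector_mult_def sum_distrib_left mult_ac)

lemma mat_inner_expand: "mat_inner A B = (\<Sum>i\<in>UNIV. \<Sum>j\<in>UNIV. A $ i $ j * B $ i $ j)"
  by (simp add: mat_inner_def trace_def matrix_matrix_mult_def transpose_def)

lemma mat_inner_outer: "mat_inner A (outer y x) = y \<bullet> (A *v x)"
  by (simp add: mat_inner_expand inner_mat_expand outer_def mult_ac)

lemma outer_mult_vec: "outer a b *v y = (b \<bullet> y) *\<^sub>R a"
  by (simp add: vec_eq_iff outer_def matrix_vector_mult_def inner_vec_def sum_distrib_left mult_ac)

lemma inner_outer: "x \<bullet> (outer a b *v y) = (a \<bullet> x) * (b \<bullet> y)"
  by (simp add: outer_mult_vec inner_commute)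

lemma psd_outer: "psd (outer g g)"
  unfolding psd_def by (auto intro!: sym_matsI simp: inner_outer) (simp add: outer_def)

lemma psd_add: "psd A \<Longrightarrow> psd B \<Longrightarrow> psd (A + B)"
  by (auto simp: psd_def sym_mats_def transpose_def vec_eq_iff matrix_vector_mult_add_rdistrib inner_add_right)

lemma psd_scale: "psd A \<Longrightarrow> 0 \<le> a \<Longrightarrow> psd (a *\<^sub>R A)"
  by (auto simp: psd_def sym_mats_def transpose_def vec_eq_iff scaleR_matrix_vector_assoc[symmetric])

lemma psd_zero: "psd 0"
  by (simp add: psd_def sym_mats_def transpose_def vec_eq_iff)

lemma psd_entry:
  assumes "psd A"
  shows "2 * \<bar>A $ i $ j\<bar> \<le> A $ i $ i + A $ j $ j"
proof -
  have s: "A $ j $ i = A $ i $ j"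
    using assms by (simp add: psd_def sym_matsD)
  have e: "axis k 1 \<bullet> (A *v axis l 1) = A $ k $ l" for k l
    by (simp add: inner_axis' matrix_vector_mul_component inner_axis row_def)
  have "0 \<le> (axis i 1 + axis j 1) \<bullet> (A *v (axis i 1 + axis j 1))"
    and "0 \<le> (axis i 1 - axis j 1) \<bullet> (A *v (axis i 1 - axis j 1))"
    using assms by (auto simp: psd_def)
  then show ?thesis
    by (simp add: matrix_vector_right_distrib matrix_vector_mult_diff_distrib
        inner_add_left inner_add_right inner_diff_left inner_diff_right e s abs_le_iff)
qed

lemma psd_diag: "psd A \<Longrightarrow> 0 \<le> A $ i $ i"
  using psd_entry[of A i i] by simp

text \<open>
  Cholesky elimination: a nonzero diagonal entry is split off as a rank one matrix, which clears
  its row, and the nonzero diagonal entries become fewer. The first conjunct keeps the index of the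
  pivot free for the new vector.
\<close>
lemma psd_factor:
  fixes P :: "real ^ 'n ^ 'n"
  assumes "psd P"
  shows "\<exists>g. (\<forall>i. P $ i $ i = 0 \<longrightarrow> g i = 0) \<and> P = (\<Sum>k\<in>UNIV. outer (g k) (g k))"
  using assms
proof (induction "card {i. P $ i $ i \<noteq> 0}" arbitrary: P rule: less_induct)
  case less
  have zero_row: "P $ i $ j = 0" if "P $ i $ i = 0" for i j
  proof (rule ccontr)
    assume nz: "P $ i $ j \<noteq> 0"
    \<comment> \<open>along this line the form is affine in \<open>t\<close>, and this \<open>t\<close> gives it the value \<open>-1\<close>\<close>
    define t where "t = - (P $ j $ j + 1) / (2 * P $ i $ j)"
    let ?x = "t *\<^sub>R axis i 1 + axis j 1"
    have e: "axis k 1 \<bullet> (P *v axis l 1) = P $ k $ l" for k l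
      by (simp add: inner_axis' matrix_vector_mul_component inner_axis row_def)
    have "?x \<bullet> (P *v ?x) = t * t * P $ i $ i + t * (P $ i $ j + P $ j $ i) + P $ j $ j"
      by (simp add: matrix_vector_right_distrib matrix_vector_mult_scaleR inner_add_left inner_add_right e
          algebra_simps)
    also have "P $ j $ i = P $ i $ j"
      using less.prems by (simp add: psd_def sym_matsD)
    finally have "?x \<bullet> (P *v ?x) = - 1"
      using nz that by (simp add: t_def field_simps)
    moreover have "0 \<le> ?x \<bullet> (P *v ?x)"
      using less.prems by (auto simp: psd_def)
    ultimately show False by simp
  qed
  show ?case
  proof (cases "\<exists>i. P $ i $ i \<noteq> 0")
    case False
    then have "P = (\<Sum>k\<in>UNIV. outer 0 0)"
      using zero_row by (simp add: vec_eq_iff outer_def)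
    then show ?thesis by (intro exI[of _ "\<lambda>_. 0"]) simp
  next
    case True
    then obtain i where i: "P $ i $ i \<noteq> 0" by blast
    with psd_diag[OF less.prems, of i] have pos: "P $ i $ i > 0" by simp
    define h where "h = (1 / sqrt (P $ i $ i)) *\<^sub>R row i P"
    define P' where "P' = P - outer h h"
    have P'_nth: "P' $ k $ l = P $ k $ l - P $ i $ k * P $ i $ l / P $ i $ i" for k l
      using pos by (simp add: P'_def h_def outer_def row_def)
    have sym: "P \<in> sym_mats" using less.prems by (simp add: psd_def)
    have "psd P'"
      unfolding psd_def
    proof (intro conjI allI)
      show "P' \<in> sym_mats"
        using sym_matsD[OF sym] by (intro sym_matsI) (simp add: P'_nth mult.commute)
    next
      fix x
      \<comment> \<open>Completing the square: moving \<open>x\<close> along the pivot direction minimises the form.\<close>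
      define t where "t = (row i P \<bullet> x) / P $ i $ i"
      let ?y = "x - t *\<^sub>R axis i 1"
      have c1: "axis i 1 \<bullet> (P *v x) = row i P \<bullet> x"
        by (simp add: inner_axis' matrix_vector_mul_component row_def)
      have c2: "x \<bullet> (P *v axis i 1) = row i P \<bullet> x"
        using sym_inner_swap[OF sym, of x "axis i 1"] c1 by (simp add: inner_commute)
      have c3: "axis i 1 \<bullet> (P *v axis i 1) = P $ i $ i"
        by (simp add: inner_axis' matrix_vector_mul_component inner_axis row_def)
      have "?y \<bullet> (P *v ?y) = x \<bullet> (P *v x) - 2 * t * (row i P \<bullet> x) + t * t * P $ i $ i"
        by (simp add: matrix_vector_mult_diff_distrib matrix_vector_mult_scaleR inner_diff_left
            inner_diff_right c1 c2 c3 algebra_simps)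
      also have "\<dots> = x \<bullet> (P *v x) - (row i P \<bullet> x)\<^sup>2 / P $ i $ i"
        using pos by (simp add: t_def field_simps power2_eq_square)
      also have "\<dots> = x \<bullet> (P' *v x)"
        using pos by (simp add: P'_def matrix_vector_mult_diff_rdistrib inner_diff_right inner_outer h_def
            power2_eq_square)
      finally show "0 \<le> x \<bullet> (P' *v x)"
        using less.prems by (metis psd_def)
    qed
    have P'i: "P' $ i $ i = 0" using pos by (simp add: P'_nth)
    have sub: "P' $ k $ k = 0" if "P $ k $ k = 0" for k
      using zero_row[OF that, of i] zero_row[OF that, of k] sym_matsD[OF sym, of k i] by (simp add: P'_nth)
    have "{k. P' $ k $ k \<noteq> 0} \<subset> {k. P $ k $ k \<noteq> 0}"
      using sub i P'i by auto
    then have "card {k. P' $ k $ k \<noteq> 0} < card {k. P $ k $ k \<noteq> 0}"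
      by (intro psubset_card_mono) auto
    from less.hyps[OF this \<open>psd P'\<close>] obtain g where
      g: "\<And>k. P' $ k $ k = 0 \<Longrightarrow> g k = 0" "P' = (\<Sum>k\<in>UNIV. outer (g k) (g k))" by blast
    have "(\<Sum>k\<in>UNIV. outer ((g(i := h)) k) ((g(i := h)) k))
        = outer h h + (\<Sum>k\<in>UNIV - {i}. outer (g k) (g k))"
      by (subst sum.remove[of _ i]) auto
    also have "(\<Sum>k\<in>UNIV - {i}. outer (g k) (g k)) = P'"
      unfolding g(2) using g(1)[OF P'i] by (subst sum.remove[of UNIV i]) (auto simp: outer_def vec_eq_iff)
    finally have "P = (\<Sum>k\<in>UNIV. outer ((g(i := h)) k) ((g(i := h)) k))"
      by (simp add: P'_def)
    then show ?thesis
      using g(1) sub i by (intro exI[of _ "g(i := h)"]) auto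
  qed
qed

lemma psd_inner_nonneg:
  fixes A B :: "real ^ 'a ^ 'a"
  assumes "psd A" "psd B"
  shows "0 \<le> mat_inner A B"
proof -
  obtain g :: "'a \<Rightarrow> real ^ 'a" where g: "B = (\<Sum>k\<in>UNIV. outer (g k) (g k))"
    using psd_factor[OF assms(2)] by blast
  have lin: "mat_inner A (\<Sum>k\<in>K. f k) = (\<Sum>k\<in>K. mat_inner A (f k))" for K and f :: "'a \<Rightarrow> real ^ 'a ^ 'a"
    unfolding mat_inner_expand
    by (induction K rule: infinite_finite_induct) (auto simp: algebra_simps sum.distrib)
  have "mat_inner A B = (\<Sum>k\<in>UNIV. g k \<bullet> (A *v g k))"
    unfolding g lin by (simp add: mat_inner_outer)
  also have "\<dots> \<ge> 0" using assms(1) by (intro sum_nonneg) (auto simp: psd_def)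
  finally show ?thesis .
qed

section \<open>The strict S-lemma\<close>

text \<open>
  At an interior zero of a nonnegative quadratic function the linear term cancels between \<open>t\<close> and
  \<open>- t\<close>, which leaves the quadratic form itself.
\<close>
lemma quadratic_nonneg_near_0:
  fixes a b d :: real
  assumes d: "d > 0" and nn: "\<And>t. \<bar>t\<bar> < d \<Longrightarrow> 0 \<le> t * b + t * t * a"
  shows "0 \<le> a"
proof -
  have "0 \<le> (d/2) * b + (d/2) * (d/2) * a" "0 \<le> (-(d/2)) * b + (-(d/2)) * (-(d/2)) * a"
    using d by (intro nn; simp)+
  then have "0 \<le> (d * d) * a" by (simp add: algebra_simps)
  moreover have "0 < d * d" using d by simp
  ultimately show ?thesis by (simp only: zero_le_mult_iff) (auto simp: not_less)
qed

text \<open>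
  The number \<open>\<mu>\<close> is the minimum of the quotient \<open>f / g\<close> of the two forms over \<open>g > 0\<close>. The form
  \<open>f - \<mu> g\<close> is then nonnegative on the open cone \<open>g > 0\<close> and vanishes at the minimiser, so it is
  nonnegative everywhere.
\<close>
lemma strict_S_lemma:
  fixes A B :: "real ^ 'n ^ 'n"
  assumes ex: "0 < x0 \<bullet> (B *v x0)"
    and pos: "\<And>x. x \<noteq> 0 \<Longrightarrow> 0 \<le> x \<bullet> (B *v x) \<Longrightarrow> 0 < x \<bullet> (A *v x)"
  shows "\<exists>\<mu>>0. \<forall>x. \<mu> * (x \<bullet> (B *v x)) \<le> x \<bullet> (A *v x)"
proof -
  define f where "f x = x \<bullet> (A *v x)" for x
  define g where "g x = x \<bullet> (B *v x)" for x
  have cont: "continuous_on S f" "continuous_on S g" for S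
    unfolding f_def g_def by (intro continuous_intros matrix_vector_mult_linear_continuous_on)+
  have hom: "f (c *\<^sub>R x) = c\<^sup>2 * f x" "g (c *\<^sub>R x) = c\<^sup>2 * g x" for c x
    by (auto simp: f_def g_def matrix_vector_mult_scaleR power2_eq_square)
  define K where "K = {x. norm x = 1 \<and> 0 \<le> g x}"
  have "K = sphere 0 1 \<inter> {x. 0 \<le> g x}" by (auto simp: K_def)
  moreover have "closed {x. 0 \<le> g x}"
    by (intro closed_Collect_le cont continuous_on_const)
  ultimately have K: "compact K" by auto
  have x0: "x0 \<noteq> 0" using ex by auto
  define x1 where "x1 = (1 / norm x0) *\<^sub>R x0"
  have gx1: "g x1 > 0" using ex x0 by (simp add: x1_def hom(2) g_def[symmetric])
  have x1: "x1 \<in> K" using x0 gx1 by (simp add: K_def x1_def)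
  then have "\<exists>x\<in>K. \<forall>y\<in>K. f x \<le> f y"
    using K cont by (intro continuous_attains_inf) auto
  then obtain xm where xm: "xm \<in> K" "\<And>y. y \<in> K \<Longrightarrow> f xm \<le> f y" by blast
  have fK: "f y > 0" if "y \<in> K" for y
    using that pos[of y] by (force simp: K_def f_def g_def)
  define \<delta> where "\<delta> = min (g x1) (g x1 * f xm / f x1)"
  have \<delta>: "\<delta> > 0" using gx1 fK[OF xm(1)] fK[OF x1] by (simp add: \<delta>_def)
  \<comment> \<open>The quotient \<open>f / g\<close> blows up at the boundary of \<open>K\<close>, so its minimum over \<open>g \<ge> \<delta>\<close> is its minimum over \<open>K\<close>.\<close>
  define K' where "K' = K \<inter> {x. \<delta> \<le> g x}"
  have "closed {x. \<delta> \<le> g x}"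
    by (intro closed_Collect_le cont continuous_on_const)
  then have "compact K'" using K by (auto simp: K'_def)
  moreover have x1': "x1 \<in> K'" using x1 by (simp add: K'_def \<delta>_def)
  moreover have "continuous_on K' (\<lambda>x. f x / g x)"
    using \<delta> by (intro continuous_intros cont) (auto simp: K'_def)
  ultimately have "\<exists>x\<in>K'. \<forall>y\<in>K'. f x / g x \<le> f y / g y"
    by (intro continuous_attains_inf) auto
  then obtain xs where xs: "xs \<in> K'" "\<And>y. y \<in> K' \<Longrightarrow> f xs / g xs \<le> f y / g y" by blast
  define \<mu> where "\<mu> = f xs / g xs"
  have gxs: "g xs > 0" using xs(1) \<delta> by (simp add: K'_def)
  have \<mu>: "\<mu> > 0" using fK[of xs] gxs xs(1) by (simp add: \<mu>_def K'_def)
  have onK: "\<mu> * g y \<le> f y" if y: "y \<in> K" for y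
  proof (cases "\<delta> \<le> g y")
    case True
    then have "g y > 0" and "\<mu> \<le> f y / g y"
      using xs(2)[of y] y \<delta> by (auto simp: K'_def \<mu>_def)
    then show ?thesis by (simp add: pos_le_divide_eq)
  next
    case False
    have "\<mu> * g y \<le> (f x1 / g x1) * g y"
      using xs(2)[OF x1'] y by (intro mult_right_mono) (auto simp: \<mu>_def K_def)
    also have "\<dots> \<le> (f x1 / g x1) * (g x1 * f xm / f x1)"
      using False fK[OF x1] gx1 by (intro mult_left_mono) (auto simp: \<delta>_def)
    also have "\<dots> = f xm" using fK[OF x1] gx1 by simp
    finally show ?thesis using xm(2)[OF y] by simp
  qed
  have on_cone: "\<mu> * g y \<le> f y" if y: "0 \<le> g y" for y
  proof (cases "y = 0")
    case False
    have "(1 / norm y) *\<^sub>R y \<in> K" using y False by (simp add: K_def hom)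
    from onK[OF this] have "(1 / norm y)\<^sup>2 * (\<mu> * g y) \<le> (1 / norm y)\<^sup>2 * f y"
      unfolding hom by (metis mult.left_commute)
    moreover have "0 < (1 / norm y)\<^sup>2" using False by simp
    ultimately show ?thesis by (simp only: mult_le_cancel_left_pos)
  qed (simp add: f_def g_def)
  have "\<mu> * g z \<le> f z" for z
  proof -
    \<comment> \<open>\<open>f - \<mu> g\<close> vanishes at \<open>xs\<close>, which is interior to the cone where it is nonnegative.\<close>
    have "open {x. 0 < g x}"
      by (intro open_Collect_less cont continuous_on_const)
    then obtain e where e: "e > 0" "ball xs e \<subseteq> {x. 0 < g x}"
      using gxs unfolding open_contains_ball by blast
    define d where "d = e / (norm z + 1)"
    have d: "d > 0" using e by (simp add: d_def add_nonneg_pos)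
    have expand: "f (xs + t *\<^sub>R z) = f xs + t * (xs \<bullet> (A *v z) + z \<bullet> (A *v xs)) + t * t * f z"
         "g (xs + t *\<^sub>R z) = g xs + t * (xs \<bullet> (B *v z) + z \<bullet> (B *v xs)) + t * t * g z" for t
      by (simp_all add: f_def g_def matrix_vector_right_distrib matrix_vector_mult_scaleR
          inner_add_left inner_add_right distrib_left)
    let ?b = "(xs \<bullet> (A *v z) + z \<bullet> (A *v xs)) - \<mu> * (xs \<bullet> (B *v z) + z \<bullet> (B *v xs))"
    have "0 \<le> t * ?b + t * t * (f z - \<mu> * g z)" if t: "\<bar>t\<bar> < d" for t
    proof -
      have "\<bar>t\<bar> * norm z \<le> \<bar>t\<bar> * (norm z + 1)" by (simp add: mult_left_mono)
      also have "\<dots> < e" using t by (simp add: d_def pos_less_divide_eq add_nonneg_pos)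
      finally have "xs + t *\<^sub>R z \<in> ball xs e" by (simp add: dist_norm)
      then have "0 \<le> g (xs + t *\<^sub>R z)" using e(2) less_imp_le by blast
      from on_cone[OF this] have "0 \<le> f (xs + t *\<^sub>R z) - \<mu> * g (xs + t *\<^sub>R z)" by simp
      also have "\<dots> = (f xs - \<mu> * g xs) + t * ?b + t * t * (f z - \<mu> * g z)"
        unfolding expand by (simp add: algebra_simps)
      also have "f xs - \<mu> * g xs = 0" using gxs by (simp add: \<mu>_def)
      finally show ?thesis by simp
    qed
    from quadratic_nonneg_near_0[OF d this] show ?thesis by simp
  qed
  then show ?thesis using \<mu> by (auto simp: f_def g_def)
qed

section \<open>Biquadratic forms that are sums of squares\<close>

definition tens :: "real ^ ('n::finite) \<Rightarrow> real ^ ('m::finite) \<Rightarrow> real ^ ('n \<times> 'm)" where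
  "tens v w = (\<chi> p. v $ fst p * w $ snd p)"

definition sos :: "(real ^ 'n::finite \<Rightarrow> real ^ 'm::finite \<Rightarrow> real) \<Rightarrow> bool" where
  "sos f \<longleftrightarrow> (\<exists>T. psd T \<and> (\<forall>v w. f v w = tens v w \<bullet> (T *v tens v w)))"

lemma sum_prod_type:
  fixes f :: "'a::finite \<times> 'b::finite \<Rightarrow> 'c::comm_monoid_add"
  shows "(\<Sum>p\<in>UNIV. f p) = (\<Sum>i\<in>UNIV. \<Sum>j\<in>UNIV. f (i, j))"
  by (simp add: sum.cartesian_product flip: UNIV_Times_UNIV)

lemma sos_add:
  assumes "sos f" "sos g"
  shows "sos (\<lambda>v w. f v w + g v w)"
proof -
  obtain S T where "psd S" "psd T" "\<And>v w. f v w = tens v w \<bullet> (S *v tens v w)"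
    "\<And>v w. g v w = tens v w \<bullet> (T *v tens v w)"
    using assms by (auto simp: sos_def)
  then show ?thesis unfolding sos_def
    by (intro exI[of _ "S + T"]) (simp add: psd_add matrix_vector_mult_add_rdistrib inner_add_right)
qed

lemma sos_scale:
  assumes "sos f" "0 \<le> a"
  shows "sos (\<lambda>v w. a * f v w)"
proof -
  obtain S where "psd S" "\<And>v w. f v w = tens v w \<bullet> (S *v tens v w)"
    using assms by (auto simp: sos_def)
  then show ?thesis using \<open>0 \<le> a\<close> unfolding sos_def
    by (intro exI[of _ "a *\<^sub>R S"]) (simp add: psd_scale flip: scaleR_matrix_vector_assoc)
qed

lemma sos_sum: "(\<And>i. i \<in> I \<Longrightarrow> sos (f i)) \<Longrightarrow> sos (\<lambda>v w. \<Sum>i\<in>I. f i v w)"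
proof (induction I rule: infinite_finite_induct)
  case (insert i I)
  then show ?case by (simp add: sos_add)
qed (auto simp: sos_def intro!: exI[of _ 0] psd_zero)

text \<open>
  By bilinearity \<open>b v w\<close> is the inner product of \<open>v \<otimes> w\<close> with the vector of values on basis pairs.
\<close>
lemma sos_square:
  fixes b :: "real ^ 'n::finite \<Rightarrow> real ^ 'm::finite \<Rightarrow> real"
  assumes "bilinear b"
  shows "sos (\<lambda>v w. (b v w)\<^sup>2)"
proof -
  define g :: "real ^ ('n \<times> 'm)" where "g = (\<chi> p. b (axis (fst p) 1) (axis (snd p) 1))"
  have "b v w = g \<bullet> tens v w" for v w
  proof -
    have "b v w = b (\<Sum>i\<in>UNIV. v $ i *\<^sub>R axis i 1) (\<Sum>j\<in>UNIV. w $ j *\<^sub>R axis j 1)"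
      using basis_expansion[of v] basis_expansion[of w] by (simp add: scalar_mult_eq_scaleR)
    also have "\<dots> = (\<Sum>(i,j)\<in>UNIV \<times> UNIV. b (v $ i *\<^sub>R axis i 1) (w $ j *\<^sub>R axis j 1))"
      by (rule bilinear_sum[OF assms])
    also have "\<dots> = g \<bullet> tens v w"
      unfolding inner_vec_def
      by (auto simp: g_def tens_def bilinear_lmul[OF assms] bilinear_rmul[OF assms]
          case_prod_unfold mult_ac intro!: sum.cong)
    finally show ?thesis .
  qed
  then show ?thesis
    unfolding sos_def
    by (intro exI[of _ "outer g g"]) (simp add: psd_outer inner_outer power2_eq_square)
qed

lemma bilinear_product:
  assumes "linear f" "linear g"
  shows "bilinear (\<lambda>v w. f v * g w :: real)"
  unfolding bilinear_def
  using assms by (auto intro!: linearI simp: linear_add linear_scale algebra_simps)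

lemma bilinear_add: "bilinear f \<Longrightarrow> bilinear g \<Longrightarrow> bilinear (\<lambda>v w. f v w + g v w)"
  by (auto simp: bilinear_def intro: linear_compose_add)

lemma bilinear_diff: "bilinear f \<Longrightarrow> bilinear g \<Longrightarrow> bilinear (\<lambda>v w. f v w - g v w)"
  by (auto simp: bilinear_def intro: linear_compose_sub)

lemma bilinear_inner:
  fixes X :: "'a::real_vector \<Rightarrow> 'e::real_inner" and Y :: "'b::real_vector \<Rightarrow> 'e"
  assumes "linear X" "linear Y"
  shows "bilinear (\<lambda>v w. X v \<bullet> Y w)"
  unfolding bilinear_def
  using assms by (auto intro!: linearI simp: linear_add linear_scale inner_add_left inner_add_right)

lemma sum_square_minors:
  fixes x y :: "'e::euclidean_space"
  shows "(\<Sum>a\<in>Basis. \<Sum>b\<in>Basis. ((x \<bullet> a) * (y \<bullet> b) - (x \<bullet> b) * (y \<bullet> a))\<^sup>2)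
    = 2 * ((x \<bullet> x) * (y \<bullet> y) - (x \<bullet> y)\<^sup>2)"
proof -
  have "(\<Sum>a\<in>Basis. \<Sum>b\<in>Basis. ((x \<bullet> a) * (y \<bullet> b) - (x \<bullet> b) * (y \<bullet> a))\<^sup>2)
     = (\<Sum>a\<in>Basis. \<Sum>b\<in>Basis. ((x \<bullet> a) * (x \<bullet> a)) * ((y \<bullet> b) * (y \<bullet> b)))
      + (\<Sum>a\<in>Basis. \<Sum>b\<in>Basis. ((y \<bullet> a) * (y \<bullet> a)) * ((x \<bullet> b) * (x \<bullet> b)))
      - 2 * (\<Sum>a\<in>Basis. \<Sum>b\<in>Basis. ((x \<bullet> a) * (y \<bullet> a)) * ((x \<bullet> b) * (y \<bullet> b)))"
    by (simp add: sum_distrib_left power2_eq_square algebra_simps flip: sum.distrib sum_subtractf)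
  also have "\<dots> = 2 * ((x \<bullet> x) * (y \<bullet> y) - (x \<bullet> y)\<^sup>2)"
    unfolding sum_product[symmetric] euclidean_inner[symmetric]
    by (simp add: power2_eq_square algebra_simps)
  finally show ?thesis .
qed

text \<open>
  Lagrange's identity turns the expression into \<open>(X v \<bullet> Y w + s)\<^sup>2\<close> plus the sum of the squares of
  all \<open>2 \<times> 2\<close> minors of the pair \<open>(X v, Y w)\<close>. This is where a Gram matrix other than the
  evident one is needed, so where the skew tensors enter.
\<close>
lemma sos_lagrange:
  fixes X :: "real ^ 'n::finite \<Rightarrow> 'e::euclidean_space" and Y :: "real ^ 'm::finite \<Rightarrow> 'e"
  assumes X: "linear X" and Y: "linear Y" and s: "bilinear s"
  shows "sos (\<lambda>v w. (X v \<bullet> X v) * (Y w \<bullet> Y w) + 2 * s v w * (X v \<bullet> Y w) + (s v w)\<^sup>2)"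
proof -
  have lin: "linear (\<lambda>v. X v \<bullet> a)" "linear (\<lambda>w. Y w \<bullet> a)" for a
    using X Y by (auto intro!: linearI simp: linear_add linear_scale inner_add_left)
  have "sos (\<lambda>v w. (1/2) * (\<Sum>a\<in>Basis. \<Sum>b\<in>Basis.
       ((X v \<bullet> a) * (Y w \<bullet> b) - (X v \<bullet> b) * (Y w \<bullet> a))\<^sup>2) + (X v \<bullet> Y w + s v w)\<^sup>2)"
    by (intro sos_add sos_scale sos_sum sos_square bilinear_add bilinear_diff bilinear_product
        bilinear_inner lin X Y s) simp
  then show ?thesis
    unfolding sum_square_minors by (simp add: power2_eq_square algebra_simps)
qed

section \<open>Strictly positive maps\<close>

text \<open>
  For a unit vector \<open>v\<close> the spatial part is the image of \<open>e\<^sub>o\<close> under the reflection in the line of \<open>v\<close>,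
  which negates the orthogonal complement of that line.
\<close>
definition nullv :: "'n::finite \<Rightarrow> real ^ 'n \<Rightarrow> real ^ 'n option" where
  "nullv o\<^sub>n v = lvec (v \<bullet> v) ((2 * v $ o\<^sub>n) *\<^sub>R v - (v \<bullet> v) *\<^sub>R axis o\<^sub>n 1)"

lemma nullv_alt: "nullv o\<^sub>n v = (v \<bullet> v) *\<^sub>R lvec 1 (- axis o\<^sub>n 1) + (2 * v $ o\<^sub>n) *\<^sub>R lvec 0 v"
  by (auto simp: nullv_def vec_eq_iff lvec_def split: option.splits)

text \<open>
  Write \<open>z = M x\<close> and let \<open>Z x = (z\<^sub>s - z\<^sub>0 e, L x)\<close>, \<open>\<zeta> x = z\<^sub>0 - e \<bullet> z\<^sub>s\<close>, with \<open>z\<^sub>s\<close> the spatial part.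
  Expanding \<open>q(v)\<close> gives \<open>q(v)\<^sup>T z = \<zeta> |v|\<^sup>2 + 2 v\<^sub>o (v, 0) \<bullet> Z + 2 z\<^sub>0 v\<^sub>o\<^sup>2\<close>, while the hypothesis on
  \<open>L\<close> says \<open>|Z|\<^sup>2 = 2 z\<^sub>0 \<zeta>\<close> at null vectors \<open>x\<close>. Translating \<open>(v, 0)\<close> by \<open>v\<^sub>o \<beta>\<close> replaces \<open>Z\<close> by
  \<open>U = Z + \<zeta> \<beta>\<close>, and \<open>\<beta>\<close> is chosen such that \<open>U\<close> vanishes at the null vector \<open>nf = (1, -e\<^sub>o)\<close>.
  As \<open>q(w) - |w|\<^sup>2 nf\<close> is a multiple of \<open>w\<^sub>o\<close>, this makes \<open>U (q w) = 2 w\<^sub>o Y w\<close> with \<open>Y\<close> linear and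
  \<open>|Y w|\<^sup>2 = \<kappa> \<zeta> (q w)\<close>, and \<open>\<kappa> q(v)\<^sup>T M q(w)\<close> becomes the form of Lagrange's identity.
\<close>
lemma sos_of_lorentz_square:
  fixes M :: "real ^ 'm::finite option ^ 'n::finite option" and L :: "real ^ 'm option \<Rightarrow> 'e::euclidean_space"
  assumes L: "linear L" and LL: "\<And>x y. L x \<bullet> L y = mink (M *v x) (M *v y) - \<mu> * mink x y"
    and \<mu>: "0 < \<mu>"
    and A: "0 < lvec 1 (- axis o\<^sub>n 1) \<bullet> (M *v lvec 1 (- axis o\<^sub>m 1))"
  shows "sos (\<lambda>v w. nullv o\<^sub>n v \<bullet> (M *v nullv o\<^sub>m w))"
proof -
  define e :: "real ^ 'n" where "e = axis o\<^sub>n 1"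
  define nf where "nf = lvec 1 (- axis o\<^sub>m 1 :: real ^ 'm)"
  define z0 where "z0 x = (M *v x) $ None" for x
  define zs where "zs x = spat (M *v x)" for x
  define \<zeta> where "\<zeta> x = z0 x - e \<bullet> zs x" for x
  define Z where "Z x = (zs x - z0 x *\<^sub>R e, L x)" for x
  define a where "a = \<zeta> nf"
  have a: "a > 0"
    using A by (simp add: a_def \<zeta>_def e_def z0_def zs_def nf_def inner_option)
  define \<beta> where "\<beta> = (- 1 / a) *\<^sub>R Z nf"
  define H where "H x = z0 x + \<beta> \<bullet> Z x + \<zeta> x * (\<beta> \<bullet> \<beta>) / 2" for x
  define U where "U x = Z x + \<zeta> x *\<^sub>R \<beta>" for x
  define \<kappa> where "\<kappa> = \<mu> / a"
  have \<kappa>: "\<kappa> > 0" using \<mu> a by (simp add: \<kappa>_def)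
  have lin0: "linear z0" "linear zs"
    by (auto intro!: linearI simp: z0_def zs_def matrix_vector_right_distrib matrix_vector_mult_scaleR spat_arith)
  have lin1: "linear \<zeta>"
    using lin0 by (auto intro!: linearI simp: \<zeta>_def linear_add linear_scale inner_add_right algebra_simps)
  have lin2: "linear Z"
    using lin0 L by (auto intro!: linearI simp: Z_def linear_add linear_scale algebra_simps)
  have lin3: "linear U" "linear H"
    using lin0 lin1 lin2
    by (auto intro!: linearI simp: U_def H_def linear_add linear_scale inner_add_right algebra_simps)
  have ee: "e \<bullet> e = 1" by (simp add: e_def)
  have ZZ: "Z x \<bullet> Z y = z0 x * \<zeta> y + z0 y * \<zeta> x - \<mu> * mink x y" for x y
    by (simp add: Z_def LL mink_def[of "M *v x"] \<zeta>_def z0_def[symmetric] zs_def[symmetric]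
        inner_diff_left inner_diff_right inner_commute ee algebra_simps)
  \<comment> \<open>\<open>U\<close> satisfies the same relation as \<open>Z\<close>, with \<open>H\<close> in place of \<open>z0\<close>\<close>
  have UU: "U x \<bullet> U y = \<zeta> y * H x + \<zeta> x * H y - \<mu> * mink x y" for x y
    by (simp add: U_def H_def ZZ inner_add_left inner_add_right inner_commute algebra_simps)
  have Unf: "U nf = 0"
    using a by (simp add: U_def \<beta>_def a_def[symmetric])
  have nf_null: "mink nf nf = 0"
    by (simp add: mink_def nf_def)
  have Hnf: "H nf = 0"
    using UU[of nf nf] a by (simp add: Unf nf_null a_def[symmetric])
  \<comment> \<open>the relation at \<open>y = nf\<close>, where \<open>U\<close> and \<open>H\<close> vanish\<close>
  have H: "H x = \<kappa> * mink x nf" for x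
    using UU[of x nf] a by (simp add: Unf Hnf a_def[symmetric] \<kappa>_def field_simps)
  define X where "X v = (v, 0) - (v $ o\<^sub>n) *\<^sub>R \<beta>" for v :: "real ^ 'n"
  define Y where "Y w = U (lvec 0 w)" for w :: "real ^ 'm"
  have linX: "linear X"
    by (auto intro!: linearI simp: X_def algebra_simps)
  have lv: "lvec 0 (x + y) = lvec 0 x + lvec 0 y" "lvec 0 (c *\<^sub>R x) = c *\<^sub>R lvec 0 x" for x y :: "real ^ 'm" and c
    by (auto simp: lvec_def vec_eq_iff split: option.splits)
  have linY: "linear Y"
    using lin3 by (auto intro!: linearI simp: Y_def lv linear_add linear_scale)
  have q\<zeta>: "\<zeta> (nullv o\<^sub>m w) = (w \<bullet> w) * a + 2 * w $ o\<^sub>m * \<zeta> (lvec 0 w)" for w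
    unfolding nullv_alt nf_def[symmetric] a_def by (simp add: linear_add[OF lin1] linear_scale[OF lin1])
  have YY: "Y w \<bullet> Y w = \<kappa> * \<zeta> (nullv o\<^sub>m w)" for w
    using a by (simp add: Y_def UU H q\<zeta> mink_def nf_def inner_axis \<kappa>_def field_simps)
  have UY: "U (nullv o\<^sub>m w) = (2 * w $ o\<^sub>m) *\<^sub>R Y w" for w
    unfolding nullv_alt nf_def[symmetric] Y_def by (simp add: linear_add[OF lin3(1)] linear_scale[OF lin3(1)] Unf)
  have HY: "H (nullv o\<^sub>m w) = 2 * \<kappa> * (w $ o\<^sub>m)\<^sup>2" for w
    by (simp add: H mink_def nf_def nullv_def inner_axis inner_diff_left power2_eq_square algebra_simps)
  define s where "s v w = 2 * \<kappa> * (v $ o\<^sub>n * w $ o\<^sub>m)" for v :: "real ^ 'n" and w :: "real ^ 'm"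
  have "bilinear (\<lambda>(v::real^'n) (w::real^'m). (2 * \<kappa> * v $ o\<^sub>n) * w $ o\<^sub>m)"
    by (intro bilinear_product) (auto intro!: linearI simp: algebra_simps)
  then have s: "bilinear s" unfolding s_def by (simp add: mult.assoc)
  have main: "\<kappa> * (nullv o\<^sub>n v \<bullet> (M *v nullv o\<^sub>m w)) =
      (X v \<bullet> X v) * (Y w \<bullet> Y w) + 2 * s v w * (X v \<bullet> Y w) + (s v w)\<^sup>2" for v w
  proof -
    define x where "x = nullv o\<^sub>m w"
    have ve: "v \<bullet> e = v $ o\<^sub>n" by (simp add: e_def inner_axis)
    have B: "nullv o\<^sub>n v \<bullet> (M *v x) = \<zeta> x * (v \<bullet> v) + 2 * v $ o\<^sub>n * ((v, 0) \<bullet> Z x) + 2 * z0 x * (v $ o\<^sub>n)\<^sup>2"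
      by (simp add: inner_option nullv_def z0_def[symmetric] zs_def[symmetric] e_def[symmetric] Z_def \<zeta>_def ve
          inner_diff_left inner_diff_right power2_eq_square algebra_simps)
    have 1: "\<zeta> x * (X v \<bullet> X v) = \<zeta> x * (v \<bullet> v) - 2 * \<zeta> x * v $ o\<^sub>n * ((v, 0) \<bullet> \<beta>)
        + \<zeta> x * (v $ o\<^sub>n)\<^sup>2 * (\<beta> \<bullet> \<beta>)"
      by (simp add: X_def inner_diff_left inner_diff_right inner_commute power2_eq_square algebra_simps)
    have 2: "4 * v $ o\<^sub>n * w $ o\<^sub>m * (X v \<bullet> Y w) = 2 * v $ o\<^sub>n * (X v \<bullet> U x)"
      unfolding x_def UY by simp
    have 3: "X v \<bullet> U x = (v, 0) \<bullet> Z x + \<zeta> x * ((v, 0) \<bullet> \<beta>) - v $ o\<^sub>n * (\<beta> \<bullet> Z x) - v $ o\<^sub>n * \<zeta> x * (\<beta> \<bullet> \<beta>)"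
      by (simp add: X_def U_def inner_diff_left inner_add_right algebra_simps)
    have 4: "4 * \<kappa> * (v $ o\<^sub>n)\<^sup>2 * (w $ o\<^sub>m)\<^sup>2 = 2 * (v $ o\<^sub>n)\<^sup>2 * H x"
      unfolding x_def HY by simp
    have "nullv o\<^sub>n v \<bullet> (M *v x) = \<zeta> x * (X v \<bullet> X v) + 4 * v $ o\<^sub>n * w $ o\<^sub>m * (X v \<bullet> Y w)
       + 4 * \<kappa> * (v $ o\<^sub>n)\<^sup>2 * (w $ o\<^sub>m)\<^sup>2"
      unfolding B 1 2 3 4 H_def by (simp add: power2_eq_square algebra_simps)
    moreover have "\<kappa> * \<zeta> x = Y w \<bullet> Y w" by (simp add: YY x_def)
    ultimately show ?thesis
      unfolding x_def[symmetric] by (simp add: s_def power2_eq_square algebra_simps)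
  qed
  have "sos (\<lambda>v w. \<kappa> * (nullv o\<^sub>n v \<bullet> (M *v nullv o\<^sub>m w)))"
    unfolding main by (rule sos_lagrange[OF linX linY s])
  from sos_scale[OF this, of "1 / \<kappa>"] \<kappa> show ?thesis by simp
qed

definition minkmat :: "real ^ 'k::finite option ^ 'k option" where
  "minkmat = (\<chi> i j. if i = j then (if i = None then 1 else - 1) else 0)"

lemma minkmat_mult_vec: "minkmat *v y = lvec (y $ None) (- spat y)"
proof -
  have "(minkmat *v y) $ i = lvec (y $ None) (- spat y) $ i" for i
  proof -
    have "(minkmat *v y) $ i = (\<Sum>j\<in>UNIV. if i = j then (if i = None then 1 else - 1) * y $ j else 0)"
      unfolding matrix_vector_mult_def minkmat_def vec_lambda_beta by (intro sum.cong) auto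
    then show ?thesis by (cases i) auto
  qed
  then show ?thesis by (simp add: vec_eq_iff)
qed

lemma inner_minkmat: "x \<bullet> (minkmat *v y) = mink x y"
  by (simp add: minkmat_mult_vec inner_option mink_def)

lemma mink_sym: "mink x y = mink y x"
  by (simp add: mink_def inner_commute)

text \<open>
  Strict positivity sends nonzero vectors of the cone to its interior, so \<open>Q(M x) > 0\<close> whenever
  \<open>x \<noteq> 0\<close> and \<open>Q(x) \<ge> 0\<close>, as the S-lemma requires; its conclusion is factored to obtain \<open>L\<close>.
\<close>
lemma sos_of_strictly_positive:
  fixes M :: "real ^ 'm::finite option ^ 'n::finite option"
  assumes \<epsilon>: "0 < \<epsilon>"
    and M: "\<And>x y. x \<in> lorentz_cone \<Longrightarrow> y \<in> lorentz_cone \<Longrightarrow> \<epsilon> * x $ None * y $ None \<le> y \<bullet> (M *v x)"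
  shows "sos (\<lambda>v w. nullv o\<^sub>n v \<bullet> (M *v nullv o\<^sub>m w))"
proof -
  define A where "A = transpose M ** minkmat ** M"
  have A: "x \<bullet> (A *v y) = mink (M *v x) (M *v y)" for x y
    unfolding A_def matrix_vector_mul_assoc[symmetric] inner_transpose inner_minkmat ..
  have cone_pos: "0 < mink (M *v x) (M *v x)" if x: "x \<in> lorentz_cone" "x \<noteq> 0" for x
  proof -
    have "0 < x $ None"
    proof (rule ccontr)
      assume "\<not> ?thesis"
      then have "x $ None = 0" "norm (spat x) = 0"
        using x(1) norm_ge_zero[of "spat x"] unfolding lorentz_cone_iff by linarith+
      then have "x = lvec 0 0" by (metis lvec_eta norm_eq_zero)
      then show False using x(2) by (auto simp: vec_eq_iff lvec_def split: option.splits)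
    qed
    moreover have "norm (spat (M *v x)) + \<epsilon> * x $ None \<le> (M *v x) $ None"
      using M[OF x(1)] by (rule lorentz_cone_self_dual_strict)
    ultimately have "norm (spat (M *v x)) < (M *v x) $ None"
      using \<epsilon> by (smt (verit) mult_pos_pos)
    then have "(norm (spat (M *v x)))\<^sup>2 < ((M *v x) $ None)\<^sup>2"
      by (intro power_strict_mono) auto
    then show ?thesis by (simp add: mink_def dot_square_norm power2_eq_square)
  qed
  have "0 < x \<bullet> (A *v x)" if x: "x \<noteq> 0" "0 \<le> x \<bullet> (minkmat *v x)" for x
  proof -
    have "(norm (spat x))\<^sup>2 \<le> (x $ None)\<^sup>2"
      using x(2) by (simp add: inner_minkmat mink_def dot_square_norm power2_eq_square)
    then have "norm (spat x) \<le> \<bar>x $ None\<bar>"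
      using abs_le_square_iff[of "norm (spat x)" "x $ None"] by simp
    then have "x \<in> lorentz_cone \<or> - x \<in> lorentz_cone"
      by (auto simp: lorentz_cone_iff spat_arith abs_if split: if_splits)
    then show ?thesis
    proof
      assume "- x \<in> lorentz_cone"
      from cone_pos[OF this] x(1) have "0 < (- x) \<bullet> (A *v (- x))" by (simp add: A)
      also have "(- x) \<bullet> (A *v (- x)) = x \<bullet> (A *v x)"
        by (simp add: linear_neg[OF matrix_vector_mul_linear])
      finally show ?thesis .
    qed (use cone_pos x(1) A in auto)
  qed
  moreover have "0 < lvec 1 (0 :: real ^ 'm) \<bullet> (minkmat *v lvec 1 0)"
    by (simp add: inner_minkmat mink_def)
  ultimately obtain \<mu> where \<mu>: "\<mu> > 0" "\<And>x. \<mu> * (x \<bullet> (minkmat *v x)) \<le> x \<bullet> (A *v x)"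
    using strict_S_lemma by blast
  define P where "P = A - \<mu> *\<^sub>R minkmat"
  have P: "x \<bullet> (P *v y) = mink (M *v x) (M *v y) - \<mu> * mink x y" for x y
    by (simp add: P_def matrix_vector_mult_diff_rdistrib inner_diff_right A inner_minkmat
        flip: scaleR_matrix_vector_assoc)
  have "P \<in> sym_mats"
  proof (rule sym_matsI)
    fix i j
    have "P $ i $ j = axis i 1 \<bullet> (P *v axis j 1)" for i j
      by (simp add: inner_axis' matrix_vector_mul_component inner_axis)
    then show "P $ i $ j = P $ j $ i" by (simp add: P mink_sym)
  qed
  then have "psd P"
    using \<mu>(2) by (auto simp: psd_def P inner_minkmat A)
  then obtain g :: "'m option \<Rightarrow> real ^ 'm option" where g: "P = (\<Sum>k\<in>UNIV. outer (g k) (g k))"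
    using psd_factor by blast
  define L where "L x = (\<chi> k. g k \<bullet> x)" for x
  have "linear L"
    by (auto intro!: linearI simp: L_def vec_eq_iff inner_add_right)
  moreover have "L x \<bullet> L y = mink (M *v x) (M *v y) - \<mu> * mink x y" for x y
  proof -
    have "linear (\<lambda>A::real^'m option^'m option. x \<bullet> (A *v y))"
      by (auto intro!: linearI simp: matrix_vector_mult_add_rdistrib inner_add_right
          simp flip: scaleR_matrix_vector_assoc)
    from linear_sum[OF this, of "\<lambda>k. outer (g k) (g k)" UNIV]
    have "x \<bullet> (P *v y) = (\<Sum>k\<in>UNIV. (g k \<bullet> x) * (g k \<bullet> y))"
      unfolding g by (simp add: inner_outer)
    moreover have "L x \<bullet> L y = (\<Sum>k\<in>UNIV. (g k \<bullet> x) * (g k \<bullet> y))"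
      by (simp add: L_def inner_vec_def[of "\<chi> k. g k \<bullet> x"])
    ultimately show ?thesis by (simp add: P)
  qed
  moreover have "0 < lvec 1 (- axis o\<^sub>n 1) \<bullet> (M *v lvec 1 (- axis o\<^sub>m 1))"
    using M[of "lvec 1 (- axis o\<^sub>m 1)" "lvec 1 (- axis o\<^sub>n 1)"] \<epsilon> by (simp add: lorentz_cone_lvec)
  ultimately show ?thesis by (intro sos_of_lorentz_square[OF _ _ \<mu>(1)])
qed

section \<open>Tensor products of skew matrices\<close>

lemma tens_axis: "tens (axis i 1) (axis j 1) = axis (i, j) 1"
  by (auto simp: tens_def axis_def vec_eq_iff)

lemma tens_arith:
  "tens (v + v') w = tens v w + tens v' w" "tens v (w + w') = tens v w + tens v w'"
  by (simp_all add: tens_def vec_eq_iff algebra_simps)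

lemma inner_tens: "tens v w \<bullet> tens v' w' = (v \<bullet> v') * (w \<bullet> w')"
  by (simp add: inner_vec_def tens_def sum_prod_type sum_product mult_ac)

lemma kron_mult_tens: "kron B D *v tens v w = tens (B *v v) (D *v w)"
  by (simp add: vec_eq_iff matrix_vector_mult_def kron_def tens_def sum_prod_type sum_product mult_ac)

lemma kron_quadratic: "tens v w \<bullet> (kron B D *v tens v w) = (v \<bullet> (B *v v)) * (w \<bullet> (D *v w))"
  by (simp add: kron_mult_tens inner_tens)

lemma linear_mat_inner: "linear (\<lambda>A. mat_inner A B)"
  by (auto intro!: linearI simp: mat_inner_expand sum.distrib sum_distrib_left algebra_simps)

lemma mat_inner_commute: "mat_inner A B = mat_inner B A"
  by (simp add: mat_inner_expand mult.commute)

lemma linear_mat_inner_right: "linear (\<lambda>B. mat_inner A B)"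
  using linear_mat_inner[of A] by (simp add: mat_inner_commute[of A])

lemma skew_quadratic: "B \<in> skew_mats \<Longrightarrow> v \<bullet> (B *v v) = 0"
proof -
  assume "B \<in> skew_mats"
  then have "transpose B = - B" by (simp add: skew_mats_def)
  moreover have "v \<bullet> (B *v v) = (transpose B *v v) \<bullet> v"
    by (metis dot_lmul_matrix transpose_matrix_vector)
  moreover have "(- B) *v v = - (B *v v)"
    by (simp add: vec_eq_iff matrix_vector_mult_def sum_negf)
  ultimately have "v \<bullet> (B *v v) = - (v \<bullet> (B *v v))" by (simp add: inner_commute)
  then show ?thesis by simp
qed

lemma skew_tensor_quadratic:
  assumes "J \<in> skew_tensor"
  shows "tens v w \<bullet> (J *v tens v w) = 0"
proof -
  have "mat_inner J (outer (tens v w) (tens v w)) = 0"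
    using assms unfolding skew_tensor_def
    by (rule linear_eq_0_on_span[OF linear_mat_inner, rotated])
      (auto simp: mat_inner_outer kron_quadratic skew_quadratic)
  then show ?thesis by (simp add: mat_inner_outer)
qed

lemma mat_inner_mat_1: "mat_inner A (mat 1) = trace A"
proof -
  have "(\<Sum>j\<in>UNIV. A $ i $ j * mat 1 $ i $ j) = A $ i $ i" for i
  proof -
    have "(\<Sum>j\<in>UNIV. A $ i $ j * mat 1 $ i $ j) = (\<Sum>j\<in>UNIV. if i = j then A $ i $ j else 0)"
      by (intro sum.cong) (auto simp: mat_def)
    then show ?thesis by simp
  qed
  then show ?thesis by (simp add: mat_inner_expand trace_def)
qed

lemma skew_tensor_trace:
  assumes "J \<in> skew_tensor"
  shows "trace J = 0"
proof -
  have "trace (kron B D) = 0" if "B \<in> skew_mats" for B :: "real ^ 'a ^ 'a" and D :: "real ^ 'b ^ 'b"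
  proof -
    have "B $ i $ i = 0" for i
    proof -
      have "transpose B $ i $ i = (- B) $ i $ i" using that by (simp add: skew_mats_def)
      then show ?thesis by (simp add: transpose_def)
    qed
    then show ?thesis by (simp add: trace_def kron_def)
  qed
  then have "mat_inner J (mat 1) = 0"
    using assms unfolding skew_tensor_def
    by (intro linear_eq_0_on_span[OF linear_mat_inner, of _ _ J]) (auto simp: mat_inner_mat_1)
  then show ?thesis by (simp add: mat_inner_mat_1)
qed

definition skew_unit :: "'k::finite \<Rightarrow> 'k \<Rightarrow> real ^ 'k ^ 'k" where
  "skew_unit i k = outer (axis i 1) (axis k 1) - outer (axis k 1) (axis i 1)"

lemma skew_unit_nth:
  "skew_unit i k $ a $ c = of_bool (i = a) * of_bool (k = c) - of_bool (k = a) * of_bool (i = c)"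
  by (auto simp: skew_unit_def outer_def axis_def)

lemma skew_unit_skew: "skew_unit i k \<in> skew_mats"
  by (auto simp: skew_mats_def transpose_def vec_eq_iff skew_unit_def outer_def)

lemma sum_mult_of_bool: "(\<Sum>l\<in>UNIV. h l * of_bool (l = d)) = h d"
  for h :: "'a::finite \<Rightarrow> real"
proof -
  have "(\<Sum>l\<in>UNIV. h l * of_bool (l = d)) = (\<Sum>l\<in>UNIV. if l = d then h l else 0)"
    by (intro sum.cong) auto
  then show ?thesis by simp
qed

text \<open>
  Polarising in each factor shows that the entries of \<open>E\<close> change sign when the two indices of one
  factor are exchanged. Hence \<open>E\<close> equals its projection to \<open>\<A>(n) \<otimes> \<A>(m)\<close>, which is the sum below;
  the factor \<open>1/4\<close> compensates for each basis tensor being met four times.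
\<close>
lemma skew_tensorI:
  fixes E :: "real ^ ('n::finite \<times> 'm::finite) ^ ('n \<times> 'm)"
  assumes sym: "E \<in> sym_mats" and zero: "\<And>v w. tens v w \<bullet> (E *v tens v w) = 0"
  shows "E \<in> skew_tensor"
proof -
  have pol1: "tens v w \<bullet> (E *v tens v' w) = 0" for v v' w
  proof -
    have "tens (v + v') w \<bullet> (E *v tens (v + v') w) = 2 * (tens v w \<bullet> (E *v tens v' w))"
      using sym_inner_swap[OF sym, of "tens v' w" "tens v w"]
      by (simp add: tens_arith matrix_vector_right_distrib inner_add_left inner_add_right zero inner_commute)
    then show ?thesis by (simp add: zero)
  qed
  have pol2: "tens v w \<bullet> (E *v tens v' w') = - (tens v w' \<bullet> (E *v tens v' w))" for v v' w w'
    using pol1[of v "w + w'" v']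
    by (simp add: tens_arith matrix_vector_right_distrib inner_add_left inner_add_right pol1 add_eq_0_iff)
  have entry: "E $ (i, j) $ (k, l) = tens (axis i 1) (axis j 1) \<bullet> (E *v tens (axis k 1) (axis l 1))" for i j k l
    by (simp add: tens_axis inner_axis' matrix_vector_mul_component inner_axis)
  have skew2: "E $ (i, l) $ (k, j) = - E $ (i, j) $ (k, l)" for i j k l
    by (simp add: entry pol2[of "axis i 1" "axis l 1"])
  have swap: "E $ (k, l) $ (i, j) = E $ (i, j) $ (k, l)" for i j k l
    by (rule sym_matsD[OF sym])
  have skew1: "E $ (k, j) $ (i, l) = - E $ (i, j) $ (k, l)" for i j k l
    by (metis skew2 swap)
  let ?K = "\<Sum>i\<in>UNIV. \<Sum>k\<in>UNIV. \<Sum>j\<in>UNIV. \<Sum>l\<in>UNIV. (E $ (i, j) $ (k, l) / 4) *\<^sub>R kron (skew_unit i k) (skew_unit j l)"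
  have delta: "(\<Sum>i\<in>UNIV. \<Sum>k\<in>UNIV. \<Sum>j\<in>UNIV. \<Sum>l\<in>UNIV.
       e i k j l * (of_bool (i = a) * of_bool (k = c) * (of_bool (j = b) * of_bool (l = d)))) = e a c b d"
    for e :: "'n \<Rightarrow> 'n \<Rightarrow> 'm \<Rightarrow> 'm \<Rightarrow> real" and a b c d
    unfolding mult.assoc[symmetric] sum_mult_of_bool ..
  have "?K $ (a, b) $ (c, d) = E $ (a, b) $ (c, d)" for a b c d
  proof -
    have "?K $ (a, b) $ (c, d) = (\<Sum>i\<in>UNIV. \<Sum>k\<in>UNIV. \<Sum>j\<in>UNIV. \<Sum>l\<in>UNIV.
        (E $ (i, j) $ (k, l) / 4) * (skew_unit i k $ a $ c * skew_unit j l $ b $ d))"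
      by (simp add: kron_def)
    also have "\<dots> = (\<Sum>i\<in>UNIV. \<Sum>k\<in>UNIV. \<Sum>j\<in>UNIV. \<Sum>l\<in>UNIV.
        (E $ (i, j) $ (k, l) / 4) * (of_bool (i = a) * of_bool (k = c) * (of_bool (j = b) * of_bool (l = d))))
      - (\<Sum>i\<in>UNIV. \<Sum>k\<in>UNIV. \<Sum>j\<in>UNIV. \<Sum>l\<in>UNIV.
        (E $ (i, j) $ (k, l) / 4) * (of_bool (i = a) * of_bool (k = c) * (of_bool (j = d) * of_bool (l = b))))
      - (\<Sum>i\<in>UNIV. \<Sum>k\<in>UNIV. \<Sum>j\<in>UNIV. \<Sum>l\<in>UNIV.
        (E $ (i, j) $ (k, l) / 4) * (of_bool (i = c) * of_bool (k = a) * (of_bool (j = b) * of_bool (l = d))))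
      + (\<Sum>i\<in>UNIV. \<Sum>k\<in>UNIV. \<Sum>j\<in>UNIV. \<Sum>l\<in>UNIV.
        (E $ (i, j) $ (k, l) / 4) * (of_bool (i = c) * of_bool (k = a) * (of_bool (j = d) * of_bool (l = b))))"
      unfolding skew_unit_nth sum_subtractf[symmetric] sum.distrib[symmetric]
      by (intro sum.cong refl) (simp add: algebra_simps)
    also have "\<dots> = E $ (a, b) $ (c, d)"
      unfolding delta using skew2[of a d c b] skew1[of c b a d] swap[of a b c d] by simp
    finally show ?thesis .
  qed
  then have "E = ?K"
    by (simp add: vec_eq_iff del: sum_component)
  moreover have "?K \<in> skew_tensor"
    unfolding skew_tensor_def
    by (intro span_sum span_scale span_base) (blast intro: skew_unit_skew)
  ultimately show ?thesis by simp
qed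

section \<open>The map \<open>\<W>\<close>\<close>

text \<open>
  The entry at the distinguished index fits this pattern because both rank one matrices
  contribute \<open>x\<^sub>1\<close> there.
\<close>
lemma W_decomp:
  "W o\<^sub>n x = (x $ None - x $ Some o\<^sub>n) *\<^sub>R mat 1 + outer (axis o\<^sub>n 1) (spat x) + outer (spat x) (axis o\<^sub>n 1)"
  by (auto simp: W_def vec_eq_iff outer_def axis_def mat_def)

lemma W_quadratic: "v \<bullet> (W o\<^sub>n x *v v) = nullv o\<^sub>n v \<bullet> x"
proof -
  have "v \<bullet> (W o\<^sub>n x *v v) = (x $ None - x $ Some o\<^sub>n) * (v \<bullet> v) + 2 * v $ o\<^sub>n * (v \<bullet> spat x)"
    unfolding W_decomp matrix_vector_mult_add_rdistrib inner_add_right inner_outer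
      scaleR_matrix_vector_assoc[symmetric] matrix_vector_mul_lid inner_scaleR_right
    by (simp add: inner_axis' inner_commute[of "spat x" v])
  also have "\<dots> = nullv o\<^sub>n v \<bullet> x"
    unfolding nullv_def inner_option lvec_simps inner_diff_left inner_scaleR_left
    by (simp add: inner_axis' left_diff_distrib)
  finally show ?thesis .
qed

lemma W_sym: "W o\<^sub>n x $ i $ j = W o\<^sub>n x $ j $ i"
  by (auto simp: W_def)

lemma WW_quadratic: "tens v w \<bullet> (WW o\<^sub>n o\<^sub>m M *v tens v w) = nullv o\<^sub>n v \<bullet> (M *v nullv o\<^sub>m w)"
proof -
  have lin: "linear (\<lambda>A. tens v w \<bullet> (A *v tens v w))"
    by (auto intro!: linearI simp: matrix_vector_mult_add_rdistrib inner_add_right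
        simp flip: scaleR_matrix_vector_assoc)
  show ?thesis
    unfolding WW_def inner_mat_expand[of "nullv o\<^sub>n v"] linear_sum[OF lin] linear_scale[OF lin]
      kron_quadratic W_quadratic
    by (simp add: inner_axis mult.assoc)
qed

lemma WW_sym: "WW o\<^sub>n o\<^sub>m M \<in> sym_mats"
proof (rule sym_matsI)
  fix i j
  have k: "kron (W o\<^sub>n x) (W o\<^sub>m y) $ i $ j = kron (W o\<^sub>n x) (W o\<^sub>m y) $ j $ i" for x y
    unfolding kron_def vec_lambda_beta by (rule arg_cong2[where f = times]; rule W_sym)
  show "WW o\<^sub>n o\<^sub>m M $ i $ j = WW o\<^sub>n o\<^sub>m M $ j $ i"
    unfolding WW_def sum_component vector_scaleR_component by (simp only: k)
qed

lemma WW_diff: "WW o\<^sub>n o\<^sub>m (A - B) = WW o\<^sub>n o\<^sub>m A - WW o\<^sub>n o\<^sub>m B"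
  by (simp add: WW_def scaleR_diff_left sum_subtractf)

lemma WW_scale: "WW o\<^sub>n o\<^sub>m (a *\<^sub>R A) = a *\<^sub>R WW o\<^sub>n o\<^sub>m A"
  by (simp add: WW_def scaleR_sum_right)

lemma E00_nth: "E00 $ i $ j = of_bool (i = None) * of_bool (j = None)"
  by (auto simp: E00_def outer_def axis_def)

lemma W_axis_None: "W o\<^sub>n (axis None 1) = mat 1"
  by (auto simp: W_def mat_def axis_def vec_eq_iff)

lemma WW_E00: "WW o\<^sub>n o\<^sub>m E00 = mat 1"
proof -
  have "kron (W o\<^sub>n (axis None 1)) (W o\<^sub>m (axis None 1)) = mat 1"
    by (auto simp: W_axis_None kron_def mat_def vec_eq_iff prod_eq_iff)
  then show ?thesis
    unfolding WW_def sum_option by (simp add: E00_nth)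
qed

text \<open>
  The vector \<open>v\<close> is the bisector of \<open>u\<close> and \<open>e\<^sub>o\<close>. For \<open>u = - e\<^sub>o\<close> any unit vector orthogonal to \<open>e\<^sub>o\<close>
  serves, which exists because the dimension is at least 2.
\<close>
lemma nullv_onto:
  fixes u :: "real ^ 'n::finite"
  assumes "CARD('n) \<ge> 2" and u: "norm u = 1"
  obtains v where "v \<bullet> v = 1" "nullv o\<^sub>n v = lvec 1 u"
proof -
  let ?e = "axis o\<^sub>n (1::real)"
  have uu: "u \<bullet> u = 1" using u by (simp add: dot_square_norm)
  show thesis
  proof (cases "u = - ?e")
    case True
    have "\<exists>k::'n. k \<noteq> o\<^sub>n"
    proof (rule ccontr)
      assume "\<not> ?thesis"
      then have "(UNIV :: 'n set) = {o\<^sub>n}" by auto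
      then have "CARD('n) = card {o\<^sub>n}" by (rule arg_cong)
      then show False using assms(1) by simp
    qed
    then obtain k where "k \<noteq> o\<^sub>n" by blast
    then have "axis k (1::real) $ o\<^sub>n = 0" by (simp add: axis_def)
    then show thesis
      using True by (intro that[of "axis k 1"]) (simp_all add: nullv_def)
  next
    case False
    define r where "r = sqrt (2 + 2 * u $ o\<^sub>n)"
    have nn: "(u + ?e) \<bullet> (u + ?e) = 2 + 2 * u $ o\<^sub>n"
      by (simp add: inner_add_left inner_add_right uu inner_axis inner_axis')
    moreover have "u + ?e \<noteq> 0" using False by (simp add: eq_neg_iff_add_eq_0)
    ultimately have pos: "2 + 2 * u $ o\<^sub>n > 0" by (metis inner_gt_zero_iff)
    then have r: "r > 0" "r * r = 2 + 2 * u $ o\<^sub>n" by (simp_all add: r_def)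
    define v where "v = (1 / r) *\<^sub>R (u + ?e)"
    have vv: "v \<bullet> v = 1" using r pos by (simp add: v_def nn)
    have "v $ o\<^sub>n = r / 2" using r by (simp add: v_def axis_def field_simps)
    then have "2 * v $ o\<^sub>n = r" by simp
    then have "(2 * v $ o\<^sub>n) *\<^sub>R v = u + ?e" using r(1) by (simp only: v_def) simp
    then show thesis using vv by (intro that[of v]) (simp_all add: nullv_def)
  qed
qed

section \<open>Closedness of the semidefinite description\<close>

lemma psd_limit:
  fixes T :: "nat \<Rightarrow> real ^ 'k ^ 'k"
  assumes T: "\<And>n. psd (T n)" and lim: "T \<longlonglongrightarrow> A"
  shows "psd A"
proof -
  have ent: "(\<lambda>n. T n $ i $ j) \<longlonglongrightarrow> A $ i $ j" for i j
    by (intro tendsto_vec_nth lim)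
  have "A $ i $ j = A $ j $ i" for i j
  proof (rule LIMSEQ_unique[OF ent])
    have "(\<lambda>n. T n $ i $ j) = (\<lambda>n. T n $ j $ i)"
      using T by (auto simp: psd_def sym_matsD)
    then show "(\<lambda>n. T n $ i $ j) \<longlonglongrightarrow> A $ j $ i" using ent[of j i] by simp
  qed
  moreover have "0 \<le> v \<bullet> (A *v v)" for v
  proof (rule LIMSEQ_le_const)
    show "(\<lambda>n. v \<bullet> (T n *v v)) \<longlonglongrightarrow> v \<bullet> (A *v v)"
      unfolding inner_mat_expand by (intro tendsto_intros ent)
    show "\<exists>N. \<forall>n\<ge>N. 0 \<le> v \<bullet> (T n *v v)" using T by (auto simp: psd_def)
  qed
  ultimately show ?thesis by (auto simp: psd_def intro!: sym_matsI)
qed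

text \<open>
  The entries are bounded by the trace. As skew tensors have trace 0, this bounds all the
  matrices in the limit argument below.
\<close>
lemma psd_norm_bound:
  fixes A :: "real ^ 'k ^ 'k"
  assumes "psd A"
  shows "norm A \<le> real (CARD('k) * CARD('k)) * trace A"
proof -
  have ent: "\<bar>A $ i $ j\<bar> \<le> trace A" for i j
  proof -
    have "A $ k $ k \<le> trace A" for k
      unfolding trace_def using psd_diag[OF assms] by (intro member_le_sum) auto
    from this[of i] this[of j] psd_entry[OF assms, of i j] show ?thesis by linarith
  qed
  have "norm A \<le> (\<Sum>i\<in>UNIV. norm (A $ i))"
    by (simp add: norm_vec_def L2_set_le_sum)
  also have "\<dots> \<le> (\<Sum>i\<in>(UNIV::'k set). \<Sum>j\<in>(UNIV::'k set). trace A)"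
    by (intro sum_mono order_trans[OF norm_le_l1_cart] ent)
  finally show ?thesis by simp
qed

text \<open>
  Bounded traces make a subsequence of the matrices converge, and the limit is semidefinite
  and differs from \<open>K - a I\<close> by a skew tensor, because subspaces are closed.
\<close>
lemma skew_tensor_psd_closed:
  fixes K :: "real ^ ('n::finite \<times> 'm::finite) ^ ('n \<times> 'm)"
  assumes "\<And>\<alpha>. \<alpha> < a \<Longrightarrow> \<exists>J\<in>skew_tensor. psd (K - \<alpha> *\<^sub>R mat 1 + J)"
  shows "\<exists>J\<in>skew_tensor. psd (K - a *\<^sub>R mat 1 + J)"
proof -
  define \<alpha> where "\<alpha> n = a - 1 / real (Suc n)" for n
  have "\<exists>J. J \<in> skew_tensor \<and> psd (K - \<alpha> n *\<^sub>R mat 1 + J)" for n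
    using assms[of "\<alpha> n"] by (auto simp: \<alpha>_def)
  then obtain J where J: "\<And>n. J n \<in> skew_tensor" "\<And>n. psd (K - \<alpha> n *\<^sub>R mat 1 + J n)"
    by metis
  define T where "T n = K - \<alpha> n *\<^sub>R mat 1 + J n" for n
  define N where "N = real CARD('n \<times> 'm)"
  have "trace (T n) \<le> \<bar>trace K\<bar> + (\<bar>a\<bar> + 1) * N" for n
  proof -
    have "trace (T n) = trace K - \<alpha> n * N"
      using skew_tensor_trace[OF J(1), of n]
      by (simp add: T_def N_def trace_def sum.distrib sum_subtractf mat_def)
    moreover have "- \<alpha> n * N \<le> (\<bar>a\<bar> + 1) * N"
    proof (rule mult_right_mono)
      have "1 / real (Suc n) \<le> 1" by simp
      then show "- \<alpha> n \<le> \<bar>a\<bar> + 1" unfolding \<alpha>_def by linarith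
    qed (simp add: N_def)
    ultimately show ?thesis by linarith
  qed
  then have "norm (T n) \<le> N * N * (\<bar>trace K\<bar> + (\<bar>a\<bar> + 1) * N)" for n
    using psd_norm_bound[OF J(2)[of n]] unfolding T_def[symmetric] N_def of_nat_mult
    by (meson mult_left_mono of_nat_0_le_iff order_trans zero_le_mult_iff)
  then have "bounded (range T)" by (auto simp: bounded_iff)
  then obtain l r where r: "strict_mono r" and l: "(T \<circ> r) \<longlonglongrightarrow> l"
    using bounded_imp_convergent_subsequence by blast
  have "\<alpha> \<longlonglongrightarrow> a - 0"
    unfolding \<alpha>_def by (intro tendsto_intros LIMSEQ_Suc[OF lim_1_over_n])
  then have \<alpha>: "(\<alpha> \<circ> r) \<longlonglongrightarrow> a"
    using LIMSEQ_subseq_LIMSEQ[OF _ r] by simp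
  have "(\<lambda>n. (T \<circ> r) n - K + (\<alpha> \<circ> r) n *\<^sub>R mat 1) \<longlonglongrightarrow> l - K + a *\<^sub>R mat 1"
    by (intro tendsto_intros l \<alpha>)
  then have "l - K + a *\<^sub>R mat 1 \<in> skew_tensor"
  proof (rule closed_sequentially[rotated 2])
    show "closed (skew_tensor :: (real ^ ('n \<times> 'm) ^ ('n \<times> 'm)) set)"
      unfolding skew_tensor_def by (rule closed_span)
    show "(T \<circ> r) n - K + (\<alpha> \<circ> r) n *\<^sub>R mat 1 \<in> skew_tensor" for n
      using J(1)[of "r n"] by (simp add: T_def)
  qed
  moreover have "psd l"
    using J(2) by (intro psd_limit[OF _ l]) (simp add: T_def)
  ultimately show ?thesis
    by (intro bexI[of _ "l - K + a *\<^sub>R mat 1"]) simp_all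
qed

section \<open>The bilinear problem\<close>

lemma lvec_bordered:
  "lvec s w \<bullet> (bordered a b M *v lvec t u) = s * (a \<bullet> u) + t * (b \<bullet> w) + w \<bullet> (M *v u)"
proof -
  have "bordered a b M *v lvec t u = lvec (a \<bullet> u) (t *\<^sub>R b + M *v u)"
  proof -
    have "(bordered a b M *v lvec t u) $ i = lvec (a \<bullet> u) (t *\<^sub>R b + M *v u) $ i" for i
      unfolding matrix_vector_mult_def vec_lambda_beta sum_option
      by (cases i) (simp_all add: bordered_def lvec_def inner_vec_def matrix_vector_mult_def)
    then show ?thesis by (simp add: vec_eq_iff)
  qed
  then show ?thesis by (simp add: inner_option inner_add_right inner_commute)
qed

lemma inner_E00: "y \<bullet> (E00 *v x) = y $ None * x $ None"
  unfolding E00_def inner_outer by (simp add: inner_axis')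

text \<open>
  The infimum of an affine function over the ball is \<open>a - |b|\<close>, already attained on the sphere.
\<close>
lemma affine_ball_bound:
  fixes b :: "real ^ 'k::finite"
  assumes sph: "\<And>u. norm u = 1 \<Longrightarrow> m \<le> a + b \<bullet> u" and u: "norm u \<le> 1"
  shows "m \<le> a + b \<bullet> u"
proof (cases "b = 0")
  case True
  then show ?thesis using sph[of "axis undefined 1"] by simp
next
  case False
  have "m \<le> a + b \<bullet> ((- 1 / norm b) *\<^sub>R b)"
    using False by (intro sph) simp
  also have "b \<bullet> ((- 1 / norm b) *\<^sub>R b) = - norm b"
    using False by (simp add: dot_square_norm power2_eq_square)
  also have "- norm b \<le> b \<bullet> u"
    using Cauchy_Schwarz_ineq2[of b u] mult_left_mono[OF u, of "norm b"] by simp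
  finally show ?thesis by simp
qed

lemma lorentz_cone_scaled:
  assumes "y \<in> lorentz_cone"
  obtains u where "norm u \<le> 1" "y = (y $ None) *\<^sub>R lvec 1 u"
proof (cases "y $ None = 0")
  case True
  then have "spat y = 0" using assms by (simp add: lorentz_cone_iff)
  then have "y = (y $ None) *\<^sub>R lvec 1 0"
    using True by (subst lvec_eta[of y]) (auto simp: vec_eq_iff lvec_def split: option.splits)
  then show thesis by (intro that[of 0]) auto
next
  case False
  have nn: "norm (spat y) \<le> y $ None" using assms by (simp add: lorentz_cone_iff)
  then have pos: "y $ None > 0" using False norm_ge_zero[of "spat y"] by linarith
  have "y = (y $ None) *\<^sub>R lvec 1 ((1 / y $ None) *\<^sub>R spat y)"
    using False by (subst lvec_eta[of y]) (auto simp: vec_eq_iff lvec_def split: option.splits)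
  moreover have "norm ((1 / y $ None) *\<^sub>R spat y) \<le> 1"
    using nn pos by simp
  ultimately show thesis using that by blast
qed

lemma bilinear_form_min:
  fixes C :: "real ^ 'm::finite option ^ 'n::finite option"
  assumes C: "C = bordered a b M"
  obtains w u where "norm w = 1" "norm u = 1"
    "\<And>y x. norm y \<le> 1 \<Longrightarrow> norm x \<le> 1 \<Longrightarrow>
       lvec 1 w \<bullet> (C *v lvec 1 u) \<le> lvec 1 y \<bullet> (C *v lvec 1 x)"
proof -
  define \<psi> where "\<psi> p = lvec 1 (fst p) \<bullet> (C *v lvec 1 (snd p))" for p :: "(real ^ 'n) \<times> (real ^ 'm)"
  have \<psi>: "\<psi> p = a \<bullet> snd p + b \<bullet> fst p + fst p \<bullet> (M *v snd p)" for p
    by (simp add: \<psi>_def C lvec_bordered)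
  have "continuous_on (sphere 0 1 \<times> sphere 0 1) \<psi>"
    unfolding \<psi> by (intro continuous_intros linear_continuous_on_compose[OF _ matrix_vector_mul_linear])
  moreover have "sphere (0 :: real ^ 'n) 1 \<times> sphere (0 :: real ^ 'm) 1 \<noteq> {}"
    by simp
  ultimately obtain p where p: "p \<in> sphere 0 1 \<times> sphere 0 1"
    "\<And>q. q \<in> sphere 0 1 \<times> sphere 0 1 \<Longrightarrow> \<psi> p \<le> \<psi> q"
    using continuous_attains_inf[of "sphere (0 :: real ^ 'n) 1 \<times> sphere (0 :: real ^ 'm) 1" \<psi>]
    by (auto simp: compact_Times)
  have 1: "\<psi> p \<le> \<psi> (y, x)" if y: "norm y = 1" and x: "norm x \<le> 1" for y x
  proof -
    have eq: "\<psi> (y, x) = b \<bullet> y + (a + transpose M *v y) \<bullet> x" for x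
      by (simp add: \<psi> inner_add_left) (metis dot_lmul_matrix transpose_matrix_vector)
    show ?thesis
      unfolding eq by (rule affine_ball_bound[OF _ x]) (use p(2)[of "(y, _)"] y in \<open>simp add: eq\<close>)
  qed
  have 2: "\<psi> p \<le> \<psi> (y, x)" if y: "norm y \<le> 1" and x: "norm x \<le> 1" for y x
  proof -
    have eq: "\<psi> (y, x) = a \<bullet> x + (b + M *v x) \<bullet> y" for y
      by (simp add: \<psi> inner_add_left inner_add_right inner_commute[of _ y])
    show ?thesis
      unfolding eq by (rule affine_ball_bound[OF _ y]) (use 1[OF _ x] in \<open>simp add: eq\<close>)
  qed
  show thesis
    using p(1) 2 by (intro that[of "fst p" "snd p"]) (auto simp: \<psi>_def)
qed

lemma cone_lower_bound:
  fixes C :: "real ^ 'm::finite option ^ 'n::finite option"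
  assumes "\<And>w u. norm w \<le> 1 \<Longrightarrow> norm u \<le> 1 \<Longrightarrow> m \<le> lvec 1 w \<bullet> (C *v lvec 1 u)"
    and y: "y \<in> lorentz_cone" and x: "x \<in> lorentz_cone"
  shows "m * (y $ None * x $ None) \<le> y \<bullet> (C *v x)"
proof -
  obtain w where w: "norm w \<le> 1" "y = (y $ None) *\<^sub>R lvec 1 w" using lorentz_cone_scaled[OF y] .
  obtain u where u: "norm u \<le> 1" "x = (x $ None) *\<^sub>R lvec 1 u" using lorentz_cone_scaled[OF x] .
  have nn: "0 \<le> y $ None" "0 \<le> x $ None"
    using y x order_trans[OF norm_ge_zero] unfolding lorentz_cone_iff by blast+
  have "m * (y $ None * x $ None) \<le> (lvec 1 w \<bullet> (C *v lvec 1 u)) * (y $ None * x $ None)"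
    using assms(1)[OF w(1) u(1)] nn by (intro mult_right_mono) auto
  also have "\<dots> = (y $ None *\<^sub>R lvec 1 w) \<bullet> (C *v (x $ None *\<^sub>R lvec 1 u))"
    by (simp add: matrix_vector_mult_scaleR)
  also have "\<dots> = y \<bullet> (C *v x)" using w(2) u(2) by simp
  finally show ?thesis .
qed

text \<open>
  For \<open>\<alpha> < a\<close> the matrix \<open>C - \<alpha> E\<^sub>0\<^sub>0\<close> is strictly positive, and \<open>J\<close> is the difference between the Gram
  matrix of the sum of squares and \<open>\<W>(C - \<alpha> E\<^sub>0\<^sub>0)\<close>.
\<close>
lemma semidefinite_certificate:
  fixes C :: "real ^ 'm::finite option ^ 'n::finite option"
  assumes C: "\<And>y x. y \<in> lorentz_cone \<Longrightarrow> x \<in> lorentz_cone \<Longrightarrow> a * (y $ None * x $ None) \<le> y \<bullet> (C *v x)"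
  shows "\<exists>J\<in>skew_tensor. psd (WW o\<^sub>n o\<^sub>m C - a *\<^sub>R mat 1 + J)"
proof (rule skew_tensor_psd_closed)
  fix \<alpha> assume \<alpha>: "\<alpha> < a"
  define M where "M = C - \<alpha> *\<^sub>R E00"
  have M: "y \<bullet> (M *v x) = y \<bullet> (C *v x) - \<alpha> * (y $ None * x $ None)" for x y
    unfolding M_def matrix_vector_mult_diff_rdistrib inner_diff_right scaleR_matrix_vector_assoc[symmetric]
    by (simp add: inner_E00)
  have "sos (\<lambda>v w. nullv o\<^sub>n v \<bullet> (M *v nullv o\<^sub>m w))"
  proof (rule sos_of_strictly_positive)
    show "0 < a - \<alpha>" using \<alpha> by simp
    show "(a - \<alpha>) * x $ None * y $ None \<le> y \<bullet> (M *v x)"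
      if "x \<in> lorentz_cone" "y \<in> lorentz_cone" for x y
      using C[OF that(2,1)] by (simp add: M algebra_simps)
  qed
  then obtain T where T: "psd T" "\<And>v w. nullv o\<^sub>n v \<bullet> (M *v nullv o\<^sub>m w) = tens v w \<bullet> (T *v tens v w)"
    unfolding sos_def by blast
  define J where "J = T - WW o\<^sub>n o\<^sub>m M"
  have "J \<in> skew_tensor"
  proof (rule skew_tensorI)
    show "J \<in> sym_mats"
      using T(1) WW_sym[of o\<^sub>n o\<^sub>m M] by (auto simp: J_def psd_def sym_matsD intro!: sym_matsI)
    show "tens v w \<bullet> (J *v tens v w) = 0" for v w
      by (simp add: J_def matrix_vector_mult_diff_rdistrib inner_diff_right WW_quadratic T(2))
  qed
  moreover have "WW o\<^sub>n o\<^sub>m C - \<alpha> *\<^sub>R mat 1 + J = T"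
    by (simp add: J_def M_def WW_diff WW_scale WW_E00)
  ultimately show "\<exists>J\<in>skew_tensor. psd (WW o\<^sub>n o\<^sub>m C - \<alpha> *\<^sub>R mat 1 + J)"
    using T(1) by metis
qed

lemma objective_substitution:
  fixes R :: "real ^ 'm ^ 'n"
  shows "c \<bullet> (x\<^sub>c + F *v u) + d \<bullet> (y\<^sub>c + G *v w) + (y\<^sub>c + G *v w) \<bullet> (R *v (x\<^sub>c + F *v u))
    = (c \<bullet> x\<^sub>c + d \<bullet> y\<^sub>c + y\<^sub>c \<bullet> (R *v x\<^sub>c))
      + lvec 1 w \<bullet> (bordered (transpose F *v (c + transpose R *v y\<^sub>c)) (transpose G *v (d + R *v x\<^sub>c))
          (transpose G ** R ** F) *v lvec 1 u)"
proof -
  have adj: "(transpose A *v p) \<bullet> q = p \<bullet> (A *v q)" for A :: "real ^ 'i::finite ^ 'j::finite" and p q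
    by (metis inner_transpose inner_commute)
  show ?thesis
    unfolding lvec_bordered adj matrix_vector_mul_assoc[symmetric] matrix_vector_right_distrib
      inner_add_left inner_add_right inner_transpose
    by (simp add: inner_commute[of "R *v x\<^sub>c"])
qed

theorem mainTheorem3:
  fixes o\<^sub>n :: "'n::finite" and o\<^sub>m :: "'m::finite"
    and c c' x\<^sub>c :: "real ^ 'm" and d d' y\<^sub>c :: "real ^ 'n"
    and R R' :: "real ^ 'm ^ 'n"
    and F :: "real ^ 'm ^ 'm" and G :: "real ^ 'n ^ 'n"
    and C :: "real ^ 'm option ^ 'n option" and \<gamma> :: real
  assumes "CARD('n) \<ge> 2" and "CARD('m) \<ge> 2"
    and "invertible F" and "invertible G"
    and "\<gamma> = c \<bullet> x\<^sub>c + d \<bullet> y\<^sub>c + y\<^sub>c \<bullet> (R *v x\<^sub>c)"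
    and "c' = transpose F *v (c + transpose R *v y\<^sub>c)"
    and "d' = transpose G *v (d + R *v x\<^sub>c)"
    and "R' = transpose G ** R ** F"
    and "C = bordered c' d' R'"
  shows "\<exists>z.
      is_min_value {c \<bullet> x + d \<bullet> y + y \<bullet> (R *v x) |x y.
                      x \<in> ellipsoid x\<^sub>c F \<and> y \<in> ellipsoid y\<^sub>c G} z
    \<and> is_min_value {mat_inner C Z |Z. Z \<in> SEP \<and> Z $ None $ None = 1} (z - \<gamma>)
    \<and> is_max_value {\<alpha>. C - \<alpha> *\<^sub>R E00 \<in> LOP} (z - \<gamma>)
    \<and> is_max_value {\<alpha>. \<exists>J\<in>skew_tensor. psd (WW o\<^sub>n o\<^sub>m C - \<alpha> *\<^sub>R mat 1 + J)} (z - \<gamma>)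
    \<and> is_min_value {mat_inner (WW o\<^sub>n o\<^sub>m C) S |S.
                      S \<in> sym_mats \<and> psd S \<and> trace S = 1 \<and>
                      (\<forall>J\<in>skew_tensor. mat_inner J S = 0)} (z - \<gamma>)"
proof -
  obtain w u where w: "norm w = 1" and u: "norm u = 1"
    and least: "\<And>y x. norm y \<le> 1 \<Longrightarrow> norm x \<le> 1 \<Longrightarrow>
       lvec 1 w \<bullet> (C *v lvec 1 u) \<le> lvec 1 y \<bullet> (C *v lvec 1 x)"
    using bilinear_form_min[OF assms(9)] by blast
  define a where "a = lvec 1 w \<bullet> (C *v lvec 1 u)"
  have cone: "a * (y $ None * x $ None) \<le> y \<bullet> (C *v x)"
    if "y \<in> lorentz_cone" "x \<in> lorentz_cone" for y x
    using least that unfolding a_def by (intro cone_lower_bound)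
  have wL: "lvec 1 w \<in> lorentz_cone" and uL: "lvec 1 u \<in> lorentz_cone"
    using w u by (simp_all add: lorentz_cone_lvec)
  obtain v where v: "v \<bullet> v = 1" "nullv o\<^sub>n v = lvec 1 w"
    using nullv_onto[OF assms(1) w] .
  obtain v' where v': "v' \<bullet> v' = 1" "nullv o\<^sub>m v' = lvec 1 u"
    using nullv_onto[OF assms(2) u] .
  define t where "t = tens v v'"
  have tt: "t \<bullet> t = 1" by (simp add: t_def inner_tens v(1) v'(1))
  have tC: "t \<bullet> (WW o\<^sub>n o\<^sub>m C *v t) = a"
    unfolding t_def WW_quadratic v(2) v'(2) a_def ..

  have obj: "c \<bullet> (x\<^sub>c + F *v p) + d \<bullet> (y\<^sub>c + G *v q) + (y\<^sub>c + G *v q) \<bullet> (R *v (x\<^sub>c + F *v p))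
      = \<gamma> + lvec 1 q \<bullet> (C *v lvec 1 p)" for p q
    unfolding objective_substitution assms(5-9) ..
  have original: "is_min_value {c \<bullet> x + d \<bullet> y + y \<bullet> (R *v x) |x y.
      x \<in> ellipsoid x\<^sub>c F \<and> y \<in> ellipsoid y\<^sub>c G} (\<gamma> + a)"
    unfolding is_min_value_def
  proof
    have "x\<^sub>c + F *v u \<in> ellipsoid x\<^sub>c F" "y\<^sub>c + G *v w \<in> ellipsoid y\<^sub>c G"
      using u w by (force simp: ellipsoid_def)+
    then show "\<gamma> + a \<in> {c \<bullet> x + d \<bullet> y + y \<bullet> (R *v x) |x y. x \<in> ellipsoid x\<^sub>c F \<and> y \<in> ellipsoid y\<^sub>c G}"
      using obj[of u w] unfolding a_def by (smt (verit) mem_Collect_eq)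
    show "\<forall>s\<in>{c \<bullet> x + d \<bullet> y + y \<bullet> (R *v x) |x y. x \<in> ellipsoid x\<^sub>c F \<and> y \<in> ellipsoid y\<^sub>c G}. \<gamma> + a \<le> s"
      using least by (auto simp: ellipsoid_def obj a_def)
  qed

  have separable: "is_min_value {mat_inner C Z |Z. Z \<in> SEP \<and> Z $ None $ None = 1} a"
    unfolding is_min_value_def
  proof (intro conjI ballI)
    define Z where "Z = outer (lvec 1 w) (lvec 1 u)"
    have "Z \<in> SEP"
      unfolding SEP_def mem_Collect_eq
      by (intro exI[of _ 1] exI[of _ "\<lambda>_. lvec 1 w"] exI[of _ "\<lambda>_. lvec 1 u"]) (simp add: Z_def wL uL)
    moreover have "Z $ None $ None = 1" by (simp add: Z_def outer_def)
    moreover have "mat_inner C Z = a" by (simp add: Z_def mat_inner_outer a_def)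
    ultimately show "a \<in> {mat_inner C Z |Z. Z \<in> SEP \<and> Z $ None $ None = 1}" by blast
  next
    fix s assume "s \<in> {mat_inner C Z |Z. Z \<in> SEP \<and> Z $ None $ None = 1}"
    then obtain Z where s: "s = mat_inner C Z" and Z: "Z \<in> SEP" "Z $ None $ None = 1" by blast
    from Z(1) obtain k and y :: "nat \<Rightarrow> real ^ 'n option" and x :: "nat \<Rightarrow> real ^ 'm option"
      where yx: "\<And>j. j < k \<Longrightarrow> y j \<in> lorentz_cone \<and> x j \<in> lorentz_cone"
        and Zsum: "Z = (\<Sum>j<k. outer (y j) (x j))"
      unfolding SEP_def by blast
    have "a = a * (\<Sum>j<k. y j $ None * x j $ None)"
      using Z(2) by (simp add: Zsum outer_def)
    also have "\<dots> \<le> (\<Sum>j<k. y j \<bullet> (C *v x j))"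
      unfolding sum_distrib_left using yx cone by (intro sum_mono) auto
    also have "\<dots> = s"
      unfolding s Zsum by (simp add: linear_sum[OF linear_mat_inner_right] mat_inner_outer)
    finally show "a \<le> s" .
  qed

  have shifted: "y \<bullet> ((C - \<alpha> *\<^sub>R E00) *v x) = y \<bullet> (C *v x) - \<alpha> * (y $ None * x $ None)" for \<alpha> x y
    unfolding matrix_vector_mult_diff_rdistrib inner_diff_right scaleR_matrix_vector_assoc[symmetric]
    by (simp add: inner_E00)
  have positive: "is_max_value {\<alpha>. C - \<alpha> *\<^sub>R E00 \<in> LOP} a"
    unfolding is_max_value_def
  proof (intro conjI ballI)
    have "(C - a *\<^sub>R E00) *v x \<in> lorentz_cone" if "x \<in> lorentz_cone" for x
      using lorentz_cone_self_dual_strict[of 0 "(C - a *\<^sub>R E00) *v x"] cone[OF _ that]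
      by (simp add: shifted lorentz_cone_iff)
    then show "a \<in> {\<alpha>. C - \<alpha> *\<^sub>R E00 \<in> LOP}" by (simp add: LOP_def)
  next
    fix \<alpha> assume "\<alpha> \<in> {\<alpha>. C - \<alpha> *\<^sub>R E00 \<in> LOP}"
    then have "(C - \<alpha> *\<^sub>R E00) *v lvec 1 u \<in> lorentz_cone" using uL by (simp add: LOP_def)
    from lorentz_cone_inner_nonneg[OF wL this] show "\<alpha> \<le> a" by (simp add: shifted a_def)
  qed

  have semidefinite: "is_max_value {\<alpha>. \<exists>J\<in>skew_tensor. psd (WW o\<^sub>n o\<^sub>m C - \<alpha> *\<^sub>R mat 1 + J)} a"
    unfolding is_max_value_def
  proof (intro conjI ballI)
    show "a \<in> {\<alpha>. \<exists>J\<in>skew_tensor. psd (WW o\<^sub>n o\<^sub>m C - \<alpha> *\<^sub>R mat 1 + J)}"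
      using semidefinite_certificate[OF cone] by simp
  next
    fix \<alpha> assume "\<alpha> \<in> {\<alpha>. \<exists>J\<in>skew_tensor. psd (WW o\<^sub>n o\<^sub>m C - \<alpha> *\<^sub>R mat 1 + J)}"
    then obtain J where J: "J \<in> skew_tensor" "psd (WW o\<^sub>n o\<^sub>m C - \<alpha> *\<^sub>R mat 1 + J)" by blast
    have "0 \<le> t \<bullet> ((WW o\<^sub>n o\<^sub>m C - \<alpha> *\<^sub>R mat 1 + J) *v t)"
      using J(2) by (simp add: psd_def)
    also have "\<dots> = a - \<alpha>"
      unfolding matrix_vector_mult_add_rdistrib matrix_vector_mult_diff_rdistrib inner_add_right
        inner_diff_right scaleR_matrix_vector_assoc[symmetric] matrix_vector_mul_lid tC
      using skew_tensor_quadratic[OF J(1), of v v'] tt by (simp add: t_def)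
    finally show "\<alpha> \<le> a" by simp
  qed

  have dual: "is_min_value {mat_inner (WW o\<^sub>n o\<^sub>m C) S |S.
      S \<in> sym_mats \<and> psd S \<and> trace S = 1 \<and> (\<forall>J\<in>skew_tensor. mat_inner J S = 0)} a"
    unfolding is_min_value_def
  proof (intro conjI ballI)
    have "trace (outer t t) = 1"
      using tt by (simp add: trace_def outer_def inner_vec_def)
    moreover have "mat_inner J (outer t t) = 0" if "J \<in> skew_tensor" for J
      using skew_tensor_quadratic[OF that] by (simp add: mat_inner_outer t_def)
    moreover have "psd (outer t t)" "outer t t \<in> sym_mats"
      using psd_outer[of t] by (auto simp: psd_def)
    moreover have "a = mat_inner (WW o\<^sub>n o\<^sub>m C) (outer t t)"
      by (simp add: mat_inner_outer tC)
    ultimately show "a \<in> {mat_inner (WW o\<^sub>n o\<^sub>m C) S |S.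
      S \<in> sym_mats \<and> psd S \<and> trace S = 1 \<and> (\<forall>J\<in>skew_tensor. mat_inner J S = 0)}" by blast
  next
    fix s assume "s \<in> {mat_inner (WW o\<^sub>n o\<^sub>m C) S |S.
      S \<in> sym_mats \<and> psd S \<and> trace S = 1 \<and> (\<forall>J\<in>skew_tensor. mat_inner J S = 0)}"
    then obtain S where s: "s = mat_inner (WW o\<^sub>n o\<^sub>m C) S" and S: "psd S" "trace S = 1"
      "\<And>J. J \<in> skew_tensor \<Longrightarrow> mat_inner J S = 0" by blast
    obtain J where J: "J \<in> skew_tensor" "psd (WW o\<^sub>n o\<^sub>m C - a *\<^sub>R mat 1 + J)"
      using semidefinite_certificate[OF cone] by blast
    have "0 \<le> mat_inner (WW o\<^sub>n o\<^sub>m C - a *\<^sub>R mat 1 + J) S"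
      by (rule psd_inner_nonneg[OF J(2) S(1)])
    also have "\<dots> = s - a * mat_inner (mat 1) S"
      unfolding s linear_add[OF linear_mat_inner] linear_diff[OF linear_mat_inner]
        linear_scale[OF linear_mat_inner] S(3)[OF J(1)] by simp
    also have "mat_inner (mat 1) S = 1"
      using S(2) by (simp add: mat_inner_commute[of _ S] mat_inner_mat_1)
    finally show "a \<le> s" by simp
  qed
  show ?thesis
    using original separable positive semidefinite dual by (intro exI[of _ "\<gamma> + a"]) simp
qed

end
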